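(* Let $G$ be an abelian group with a character $\sigma:G\to\mathbb C^\times$ such that $|a|=1$ for all $a\in\sigma(G)$. Then the $\widehat{\mathfrak u}_\nu(\mathcal R_\sigma,\bar{\ })$-module $M$ is unitary with respect to the conjugate anti-involution $\tau$ of $\widehat{\mathfrak u}_\nu(\mathcal R_\sigma,\bar{\ })$ given by $$\tau(e_{ij}(m,\alpha))=(-1)^{m+1}e_{ij}(-m,\alpha),\qquad\tau(c)=c\qquad(1\le i,j\le\nu,\ m\in\mathbb Z,\ \alpha\in G).$$
   Context: Fix an integer $\nu\ge2$; $\mathbb N=\{0,1,2,\dots\}$. Fock space and vertex operators. Let $\Gamma=\bigoplus_{i=1}^{\nu}\mathbb{Z}\epsilon_i$ with $(\epsilon_i,\epsilon_j)=\delta_{ij}$. Let $\mathcal H$ be the complex Lie algebra spanned by $\epsilon_i(n)$ ($1\le i\le\nu$, $n\in2\mathbb Z+1$) and a central element $1$, with $[\alpha(m),\beta(n)]=\frac m2(\alpha,\beta)\delta_{m+n,0}\,1$, where $\alpha(n)=\sum_i c_i\epsilon_i(n)$ for $\alpha=\sum_i c_i\epsilon_i\in\Gamma$. Let $\varepsilon:\Gamma\times\Gamma\to\{\pm1\}$ be bimultiplicative with $\varepsilon(\epsilon_i,\epsilon_j)=1$ if $i\le j$ and $-1$ if $i>j$. Let $\bar\Gamma=\Gamma/2\Gamma$ and let $\mathbb C[\bar\Gamma]$ be the twisted group algebra with basis $e^{\bar\alpha}$ and product $e^{\bar\alpha}e^{\bar\beta}=\varepsilon(\alpha,\beta)e^{\overline{\alpha+\beta}}$.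 Let $\mathcal H^-$ be the span of $\epsilon_i(n)$, $n\in-(2\mathbb N+1)$, and $M=\mathbb C[\bar\Gamma]\otimes\mathcal S(\mathcal H^-)$: $e^{\bar\alpha}$ acts by left multiplication on the first factor; on the symmetric algebra $\mathcal S(\mathcal H^-)$, $\epsilon_i(n)$ acts by multiplication if $n<0$ and, if $n>0$, as the derivation with $\epsilon_i(n)\cdot\epsilon_j(m)=\frac n2\delta_{ij}\delta_{m+n,0}$; $1$ acts as identity. Put $E_{\pm}(\alpha,z)=\exp\big(-2\sum_{n\in\pm(2\mathbb N+1)}\frac{\alpha(n)}{n}z^{-n}\big)$, $\epsilon_i(z)=\sum_{n\in2\mathbb Z+1}\epsilon_i(n)z^{-n}$. For $a\in\mathbb C^\times$ define $X_{ij}(a,z)=\varepsilon(\epsilon_i,\epsilon_j)e^{\overline{\epsilon_i-\epsilon_j}}E_-(\epsilon_i,z)E_-(-\epsilon_j,az)E_+(\epsilon_i,z)E_+(-\epsilon_j,az)$ if $i\ne j$; $X_{ii}(1,z)=4\epsilon_i(z)$; $X_{ii}(a,z)=\frac{1+a}{1-a}\big(E_-(\epsilon_i,z)E_-(-\epsilon_i,az)E_+(\epsilon_i,z)E_+(-\epsilon_i,az)-1\big)$ if $a\ne1$. Operators $x_{ij}(a,n)$ on $M$ are defined by $X_{ij}(a,z)=\sum_{n\in\mathbb Z}x_{ij}(a,n)z^{-n}$. Unitary Lie algebra. Write $G$ additively and $\tilde\alpha=\sigma(\alpha)$. $\mathcal R_\sigma$ is the associative $\mathbb C$-algebra with basis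 $t^me^\alpha$ ($m\in\mathbb Z,\alpha\in G$), where $e^\alpha e^\beta=e^{\alpha+\beta}$ and $e^\alpha t^m=\tilde\alpha^m t^me^\alpha$. The anti-involution $\bar{\ }$ of $\mathcal R_\sigma$ is given by $\bar t=-t$, $\overline{e^\alpha}=e^{-\alpha}$. For $X\in M_\nu(\mathcal R_\sigma)$ put $X^*=\overline X^{\,t}$. $\mathfrak u_\nu(\mathcal R_\sigma,\bar{\ })=\{X\in M_\nu(\mathcal R_\sigma):X^*=-X\}$, a Lie algebra under the commutator, spanned by $e_{ij}(m,\alpha)=E_{ij}t^me^\alpha-E_{ji}\overline{t^me^\alpha}$. Let $\widehat{gl}_\nu(\mathcal R_\sigma)=gl_\nu(\mathcal R_\sigma)\oplus\mathbb Cc$ with $c$ central and $[E_{ij}t^me^\alpha,E_{kl}t^ne^\beta]=\delta_{jk}\tilde\alpha^nE_{il}t^{m+n}e^{\alpha+\beta}-\delta_{il}\tilde\beta^mE_{kj}t^{m+n}e^{\alpha+\beta}+m\delta_{il}\delta_{jk}\delta_{m+n,0}\delta_{\tilde\alpha\tilde\beta,1}\tilde\alpha^nc$; $\widehat{\mathfrak u}_\nu(\mathcal R_\sigma,\bar{\ })=\mathfrak u_\nu(\mathcal R_\sigma,\bar{\ })\oplus\mathbb Cc$ with the inherited bracket. It acts on $M$ by $2e_{ij}(m,\alpha)\mapsto x_{ij}(\tilde\alpha,m)+\delta_{m,0}\delta_{ij}(1-\delta_{\tilde\alpha,1})\frac{1+\tilde\alpha}{1-\tilde\alpha}$ (last term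 $0$ if $\tilde\alpha=1$), $c\mapsto\frac12$. Terminology. A conjugate anti-involution $\tau$ of a complex Lie algebra is a conjugate-linear map with $\tau^2=\mathrm{id}$ and $\tau([x,y])=[\tau(y),\tau(x)]$; when $|\tilde\alpha|=1$ for all $\alpha\in G$ the displayed formula (extended conjugate-linearly) is one. A module is unitary with respect to $\tau$ if it carries a positive definite Hermitian form $\langle\cdot|\cdot\rangle$ with $\langle x.w|v\rangle=\langle w|\tau(x).v\rangle$ for all $x$ in the Lie algebra and $w,v$ in the module. *)

theory Defs
  imports
    "HOL-Analysis.Finite_Cartesian_Product"
    "HOL-Library.Product_Plus"
    "HOL-Library.Poly_Mapping"
    "HOL-Library.Z2"
begin

text \<open>
  The index set \<open>{1,...,\<nu>}\<close> is a finite linearly ordered type \<open>'n\<close>, so that \<open>\<nu> = CARD('n)\<close>.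
\<close>

section \<open>The Fock space\<close>

text \<open>
  \<open>S(H\<^sup>-)\<close> is the polynomial algebra in the variables \<open>(i, k)\<close>, which stand for
  \<open>\<epsilon>\<^sub>i(-(2k+1))\<close>. The Fock space \<open>M = C[\<Gamma>/2\<Gamma>] \<otimes> S(H\<^sup>-)\<close> is the direct sum of copies of
  \<open>S(H\<^sup>-)\<close> over \<open>\<Gamma>/2\<Gamma> = (Z/2)\<^sup>\<nu>\<close>; the element \<open>Poly_Mapping.single g s\<close> is \<open>e\<^sup>g \<otimes> s\<close>.
\<close>

type_synonym 'n lattice = "int ^ 'n"
type_synonym 'n lattice2 = "bit ^ 'n"
type_synonym 'n sym = "(('n \<times> nat) \<Rightarrow>\<^sub>0 nat) \<Rightarrow>\<^sub>0 complex"
type_synonym 'n fock = "'n lattice2 \<Rightarrow>\<^sub>0 'n sym"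

definition cscale :: "complex \<Rightarrow> ('a \<Rightarrow>\<^sub>0 complex) \<Rightarrow> ('a \<Rightarrow>\<^sub>0 complex)" where
  "cscale c p = Poly_Mapping.map ((*) c) p"

definition mscale :: "complex \<Rightarrow> 'n::finite fock \<Rightarrow> 'n fock" where
  "mscale c w = Poly_Mapping.map (cscale c) w"

definition red2 :: "'n::finite lattice \<Rightarrow> 'n lattice2" where
  "red2 \<alpha> = (\<chi> i. of_int (\<alpha> $ i))"

definition rep2 :: "'n::finite lattice2 \<Rightarrow> 'n lattice" where
  "rep2 g = (\<chi> i. if g $ i = 0 then 0 else 1)"

abbreviation eps :: "'n::finite \<Rightarrow> 'n lattice" where
  "eps i \<equiv> axis i 1"

definition cocyc :: "'n::{finite,linorder} lattice \<Rightarrow> 'n lattice \<Rightarrow> complex" where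
  "cocyc \<alpha> \<beta> = (\<Prod>i\<in>UNIV. \<Prod>j\<in>UNIV. (if i \<le> j then 1 else -1) powi (\<alpha> $ i * \<beta> $ j))"

text \<open>Left multiplication by the basis element of the twisted group algebra attached to \<open>\<alpha>\<close>.\<close>

definition grp_op :: "'n::{finite,linorder} lattice \<Rightarrow> 'n fock \<Rightarrow> 'n fock" where
  "grp_op \<alpha> w = (\<Sum>g\<in>Poly_Mapping.keys w.
     Poly_Mapping.single (red2 \<alpha> + g) (cscale (cocyc \<alpha> (rep2 g)) (Poly_Mapping.lookup w g)))"

definition sym_var :: "'n \<times> nat \<Rightarrow> 'n sym" where
  "sym_var v = Poly_Mapping.single (Poly_Mapping.single v 1) 1"

definition sym_deriv :: "'n \<times> nat \<Rightarrow> 'n sym \<Rightarrow> 'n sym" where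
  "sym_deriv v p = (\<Sum>\<mu>\<in>Poly_Mapping.keys p.
     Poly_Mapping.single (\<mu> - Poly_Mapping.single v 1)
       (of_nat (Poly_Mapping.lookup \<mu> v) * Poly_Mapping.lookup p \<mu>))"

text \<open>The operator \<open>\<epsilon>\<^sub>i(n)\<close>. It only exists for odd \<open>n\<close>; the value at even \<open>n\<close> is set to \<open>0\<close>.\<close>

definition heis :: "'n::finite \<Rightarrow> int \<Rightarrow> 'n fock \<Rightarrow> 'n fock" where
  "heis i n w =
     (if even n then 0
      else if n < 0 then Poly_Mapping.map ((*) (sym_var (i, nat ((- n - 1) div 2)))) w
      else Poly_Mapping.map (\<lambda>s. cscale (of_int n / 2) (sym_deriv (i, nat ((n - 1) div 2)) s)) w)"

definition heis_lat :: "'n::finite lattice \<Rightarrow> int \<Rightarrow> 'n fock \<Rightarrow> 'n fock" where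
  "heis_lat \<alpha> n w = (\<Sum>i\<in>UNIV. mscale (of_int (\<alpha> $ i)) (heis i n w))"


section \<open>Vertex operators\<close>

text \<open>
  A power series with operator coefficients is the sequence of its coefficients. The formal
  variable is \<open>z\<close> for \<open>E\<^sub>-\<close> and \<open>1/z\<close> for \<open>E\<^sub>+\<close>.
\<close>

type_synonym 'n opser = "nat \<Rightarrow> 'n fock \<Rightarrow> 'n fock"

definition os_one :: "'n::finite opser" where
  "os_one k w = (if k = 0 then w else 0)"

definition os_mult :: "'n::finite opser \<Rightarrow> 'n opser \<Rightarrow> 'n opser" where
  "os_mult A B k w = (\<Sum>l\<le>k. A l (B (k - l) w))"

primrec os_pow :: "'n::finite opser \<Rightarrow> nat \<Rightarrow> 'n opser" where
  "os_pow A 0 = os_one"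
| "os_pow A (Suc r) = os_mult A (os_pow A r)"

text \<open>
  The exponential of a series without constant term: then \<open>A\<^sup>r\<close> contributes to the \<open>k\<close>-th
  coefficient only for \<open>r \<le> k\<close>.
\<close>

definition os_exp :: "'n::finite opser \<Rightarrow> 'n opser" where
  "os_exp A k w = (\<Sum>r\<le>k. mscale (1 / fact r) (os_pow A r k w))"

definition os_dilate :: "complex \<Rightarrow> 'n::finite opser \<Rightarrow> 'n opser" where
  "os_dilate a A k w = mscale (a ^ k) (A k w)"

text \<open>
  \<open>Eminus \<alpha> k\<close> is the coefficient of \<open>z\<^sup>k\<close> in \<open>E\<^sub>-(\<alpha>,z)\<close>, and \<open>Eplus \<alpha> k\<close> is the coefficient of
  \<open>z\<^sup>-\<^sup>k\<close> in \<open>E\<^sub>+(\<alpha>,z)\<close>.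
\<close>

definition Eminus :: "'n::finite lattice \<Rightarrow> 'n opser" where
  "Eminus \<alpha> = os_exp (\<lambda>k w. if odd k then mscale (- 2 / of_int (- int k)) (heis_lat \<alpha> (- int k) w) else 0)"

definition Eplus :: "'n::finite lattice \<Rightarrow> 'n opser" where
  "Eplus \<alpha> = os_exp (\<lambda>k w. if odd k then mscale (- 2 / of_int (int k)) (heis_lat \<alpha> (int k) w) else 0)"

definition Eminus2 :: "'n::finite \<Rightarrow> 'n \<Rightarrow> complex \<Rightarrow> 'n opser" where
  "Eminus2 i j a = os_mult (Eminus (eps i)) (os_dilate a (Eminus (- eps j)))"

definition Eplus2 :: "'n::finite \<Rightarrow> 'n \<Rightarrow> complex \<Rightarrow> 'n opser" where
  "Eplus2 i j a = os_mult (Eplus (eps i)) (os_dilate (inverse a) (Eplus (- eps j)))"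

text \<open>
  The coefficient of \<open>z\<^sup>-\<^sup>n\<close> in \<open>E\<^sub>-(\<epsilon>\<^sub>i,z) E\<^sub>-(-\<epsilon>\<^sub>j,az) E\<^sub>+(\<epsilon>\<^sub>i,z) E\<^sub>+(-\<epsilon>\<^sub>j,az)\<close>. Applied to a fixed
  \<open>w\<close>, only finitely many summands are nonzero (see \<open>vertex_summands_finite\<close> below).
\<close>

definition vertex :: "'n::finite \<Rightarrow> 'n \<Rightarrow> complex \<Rightarrow> int \<Rightarrow> 'n fock \<Rightarrow> 'n fock" where
  "vertex i j a n w =
     Sum_any (\<lambda>(p, q). if int q - int p = n then Eminus2 i j a p (Eplus2 i j a q w) else 0)"

definition x_op :: "'n::{finite,linorder} \<Rightarrow> 'n \<Rightarrow> complex \<Rightarrow> int \<Rightarrow> 'n fock \<Rightarrow> 'n fock" where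
  "x_op i j a n w =
     (if i \<noteq> j then mscale (cocyc (eps i) (eps j)) (grp_op (eps i - eps j) (vertex i j a n w))
      else if a = 1 then mscale 4 (heis i n w)
      else mscale ((1 + a) / (1 - a)) (vertex i i a n w - (if n = 0 then w else 0)))"


section \<open>The unitary Lie algebra\<close>

text \<open>
  In \<open>R\<^sub>\<sigma>\<close> the basis element \<open>t\<^sup>m e\<^sup>\<alpha>\<close> is \<open>Poly_Mapping.single (m, \<alpha>) 1\<close>. The product of \<open>R\<^sub>\<sigma>\<close> is
  \<open>rmult \<sigma>\<close>, not the (untwisted) convolution that \<open>*\<close> denotes on this type.
\<close>

type_synonym 'g rsig = "(int \<times> 'g) \<Rightarrow>\<^sub>0 complex"
type_synonym ('n, 'g) gl = "'g rsig ^ 'n ^ 'n"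
type_synonym ('n, 'g) ghat = "('n, 'g) gl \<times> complex"

definition character :: "('g::ab_group_add \<Rightarrow> complex) \<Rightarrow> bool" where
  "character \<sigma> \<longleftrightarrow> (\<forall>\<alpha>. \<sigma> \<alpha> \<noteq> 0) \<and> (\<forall>\<alpha> \<beta>. \<sigma> (\<alpha> + \<beta>) = \<sigma> \<alpha> * \<sigma> \<beta>)"

text \<open>\<open>t\<^sup>m e\<^sup>\<alpha> \<cdot> t\<^sup>n e\<^sup>\<beta> = \<sigma>(\<alpha>)\<^sup>n t\<^sup>m\<^sup>+\<^sup>n e\<^sup>\<alpha>\<^sup>+\<^sup>\<beta>\<close>\<close>

definition rmult :: "('g::ab_group_add \<Rightarrow> complex) \<Rightarrow> 'g rsig \<Rightarrow> 'g rsig \<Rightarrow> 'g rsig" where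
  "rmult \<sigma> p q = (\<Sum>(m, \<alpha>)\<in>Poly_Mapping.keys p. \<Sum>(n, \<beta>)\<in>Poly_Mapping.keys q.
     Poly_Mapping.single (m + n, \<alpha> + \<beta>)
       (Poly_Mapping.lookup p (m, \<alpha>) * Poly_Mapping.lookup q (n, \<beta>) * \<sigma> \<alpha> powi n))"

text \<open>
  The anti-involution with \<open>t \<mapsto> -t\<close>, \<open>e\<^sup>\<alpha> \<mapsto> e\<^sup>-\<^sup>\<alpha>\<close>; thus
  \<open>t\<^sup>m e\<^sup>\<alpha> \<mapsto> e\<^sup>-\<^sup>\<alpha> (-t)\<^sup>m = (-1)\<^sup>m \<sigma>(-\<alpha>)\<^sup>m t\<^sup>m e\<^sup>-\<^sup>\<alpha>\<close>.
\<close>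

definition rbar :: "('g::ab_group_add \<Rightarrow> complex) \<Rightarrow> 'g rsig \<Rightarrow> 'g rsig" where
  "rbar \<sigma> p = (\<Sum>(m, \<alpha>)\<in>Poly_Mapping.keys p.
     Poly_Mapping.single (m, - \<alpha>) (Poly_Mapping.lookup p (m, \<alpha>) * (-1) powi m * \<sigma> (- \<alpha>) powi m))"

definition gl_mult :: "('g::ab_group_add \<Rightarrow> complex) \<Rightarrow> ('n::finite, 'g) gl \<Rightarrow> ('n, 'g) gl \<Rightarrow> ('n, 'g) gl" where
  "gl_mult \<sigma> X Y = (\<chi> i j. \<Sum>k\<in>UNIV. rmult \<sigma> (X $ i $ k) (Y $ k $ j))"

definition gl_star :: "('g::ab_group_add \<Rightarrow> complex) \<Rightarrow> ('n::finite, 'g) gl \<Rightarrow> ('n, 'g) gl" where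
  "gl_star \<sigma> X = (\<chi> i j. rbar \<sigma> (X $ j $ i))"

definition mat_unit :: "'n::finite \<Rightarrow> 'n \<Rightarrow> 'g rsig \<Rightarrow> ('n, 'g) gl" where
  "mat_unit i j r = (\<chi> k l. if k = i \<and> l = j then r else 0)"

text \<open>
  The bilinear cocycle with
  \<open>(E\<^sub>i\<^sub>j t\<^sup>m e\<^sup>\<alpha>, E\<^sub>k\<^sub>l t\<^sup>n e\<^sup>\<beta>) \<mapsto> m \<delta>\<^sub>i\<^sub>l \<delta>\<^sub>j\<^sub>k \<delta>(m+n,0) \<delta>(\<sigma>(\<alpha>)\<sigma>(\<beta>),1) \<sigma>(\<alpha>)\<^sup>n\<close>.
\<close>

definition gl_cocycle :: "('g::ab_group_add \<Rightarrow> complex) \<Rightarrow> ('n::finite, 'g) gl \<Rightarrow> ('n, 'g) gl \<Rightarrow> complex" where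
  "gl_cocycle \<sigma> X Y = (\<Sum>i\<in>UNIV. \<Sum>j\<in>UNIV.
     \<Sum>(m, \<alpha>)\<in>Poly_Mapping.keys (X $ i $ j). \<Sum>(n, \<beta>)\<in>Poly_Mapping.keys (Y $ j $ i).
       if m + n = 0 \<and> \<sigma> \<alpha> * \<sigma> \<beta> = 1
       then of_int m * \<sigma> \<alpha> powi n * Poly_Mapping.lookup (X $ i $ j) (m, \<alpha>)
              * Poly_Mapping.lookup (Y $ j $ i) (n, \<beta>)
       else 0)"

definition hat_bracket :: "('g::ab_group_add \<Rightarrow> complex) \<Rightarrow> ('n::finite, 'g) ghat \<Rightarrow> ('n, 'g) ghat \<Rightarrow> ('n, 'g) ghat" where
  "hat_bracket \<sigma> x y =
     (gl_mult \<sigma> (fst x) (fst y) - gl_mult \<sigma> (fst y) (fst x), gl_cocycle \<sigma> (fst x) (fst y))"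

definition hat_scale :: "complex \<Rightarrow> ('n::finite, 'g) ghat \<Rightarrow> ('n, 'g) ghat" where
  "hat_scale c x = ((\<chi> i j. cscale c (fst x $ i $ j)), c * snd x)"

definition hat_c :: "('n::finite, 'g) ghat" where
  "hat_c = (0, 1)"

definition u_hat :: "('g::ab_group_add \<Rightarrow> complex) \<Rightarrow> ('n::finite, 'g) ghat set" where
  "u_hat \<sigma> = {x. gl_star \<sigma> (fst x) = - fst x}"

definition e_gen :: "('g::ab_group_add \<Rightarrow> complex) \<Rightarrow> 'n::finite \<Rightarrow> 'n \<Rightarrow> int \<Rightarrow> 'g \<Rightarrow> ('n, 'g) ghat" where
  "e_gen \<sigma> i j m \<alpha> =
     (mat_unit i j (Poly_Mapping.single (m, \<alpha>) 1)
        - mat_unit j i (rbar \<sigma> (Poly_Mapping.single (m, \<alpha>) 1)), 0)"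

text \<open>
  The action of \<open>u_hat \<sigma>\<close> on the Fock space. As the \<open>e_gen \<sigma> i j m \<alpha>\<close> and \<open>hat_c\<close> span \<open>u_hat \<sigma>\<close>, the
  conditions determine \<open>\<rho>\<close> on \<open>u_hat \<sigma>\<close>; nothing is said about \<open>\<rho>\<close> elsewhere. Such a \<open>\<rho>\<close> exists, see
  \<open>fock_action_exists\<close> below. That \<open>\<rho>\<close> respects the bracket is not one of the conditions.
\<close>

definition fock_action ::
  "('g::ab_group_add \<Rightarrow> complex) \<Rightarrow> (('n::{finite,linorder}, 'g) ghat \<Rightarrow> 'n fock \<Rightarrow> 'n fock) \<Rightarrow> bool" where
  "fock_action \<sigma> \<rho> \<longleftrightarrow>
     (\<forall>x\<in>u_hat \<sigma>. \<forall>v w. \<rho> x (v + w) = \<rho> x v + \<rho> x w) \<and>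
     (\<forall>x\<in>u_hat \<sigma>. \<forall>a w. \<rho> x (mscale a w) = mscale a (\<rho> x w)) \<and>
     (\<forall>x\<in>u_hat \<sigma>. \<forall>y\<in>u_hat \<sigma>. \<forall>w. \<rho> (x + y) w = \<rho> x w + \<rho> y w) \<and>
     (\<forall>x\<in>u_hat \<sigma>. \<forall>a w. \<rho> (hat_scale a x) w = mscale a (\<rho> x w)) \<and>
     (\<forall>i j m \<alpha> w. \<rho> (hat_scale 2 (e_gen \<sigma> i j m \<alpha>)) w =
        x_op i j (\<sigma> \<alpha>) m w
        + mscale (if m = 0 \<and> i = j \<and> \<sigma> \<alpha> \<noteq> 1 then (1 + \<sigma> \<alpha>) / (1 - \<sigma> \<alpha>) else 0) w) \<and>
     (\<forall>w. \<rho> hat_c w = mscale (1 / 2) w)"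

definition conj_linear_on :: "('n::finite, 'g) ghat set \<Rightarrow> (('n, 'g) ghat \<Rightarrow> ('n, 'g) ghat) \<Rightarrow> bool" where
  "conj_linear_on L \<tau> \<longleftrightarrow>
     (\<forall>x\<in>L. \<tau> x \<in> L) \<and>
     (\<forall>x\<in>L. \<forall>y\<in>L. \<tau> (x + y) = \<tau> x + \<tau> y) \<and>
     (\<forall>x\<in>L. \<forall>a. \<tau> (hat_scale a x) = hat_scale (cnj a) (\<tau> x))"

definition conj_anti_involution ::
  "('n::finite, 'g) ghat set \<Rightarrow> (('n, 'g) ghat \<Rightarrow> ('n, 'g) ghat \<Rightarrow> ('n, 'g) ghat)
     \<Rightarrow> (('n, 'g) ghat \<Rightarrow> ('n, 'g) ghat) \<Rightarrow> bool" where
  "conj_anti_involution L br \<tau> \<longleftrightarrow>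
     conj_linear_on L \<tau> \<and>
     (\<forall>x\<in>L. \<tau> (\<tau> x) = x) \<and>
     (\<forall>x\<in>L. \<forall>y\<in>L. \<tau> (br x y) = br (\<tau> y) (\<tau> x))"

definition pos_def_hermitian :: "('n::finite fock \<Rightarrow> 'n fock \<Rightarrow> complex) \<Rightarrow> bool" where
  "pos_def_hermitian F \<longleftrightarrow>
     (\<forall>u v w. F (u + v) w = F u w + F v w) \<and>
     (\<forall>a v w. F (mscale a v) w = a * F v w) \<and>
     (\<forall>v w. F w v = cnj (F v w)) \<and>
     (\<forall>v. v \<noteq> 0 \<longrightarrow> Re (F v v) > 0)"

definition unitary_module ::
  "('n::finite, 'g) ghat set \<Rightarrow> (('n, 'g) ghat \<Rightarrow> ('n, 'g) ghat)
     \<Rightarrow> (('n, 'g) ghat \<Rightarrow> 'n fock \<Rightarrow> 'n fock) \<Rightarrow> bool" where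
  "unitary_module L \<tau> \<rho> \<longleftrightarrow>
     (\<exists>F. pos_def_hermitian F \<and> (\<forall>x\<in>L. \<forall>v w. F (\<rho> x w) v = F w (\<rho> (\<tau> x) v)))"


section \<open>Consistency checks\<close>

subsection \<open>Scalar multiplication\<close>

lemma lookup_cscale [simp]: "Poly_Mapping.lookup (cscale c p) k = c * Poly_Mapping.lookup p k"
  by (simp add: cscale_def Poly_Mapping.map.rep_eq when_def)

lemma cscale_zero [simp]: "cscale c 0 = 0"
  by (rule poly_mapping_eqI) simp

lemma cscale_single [simp]: "cscale c (Poly_Mapping.single k a) = Poly_Mapping.single k (c * a)"
  by (rule poly_mapping_eqI) (simp add: lookup_single when_def)

lemma lookup_mscale [simp]: "Poly_Mapping.lookup (mscale c w) g = cscale c (Poly_Mapping.lookup w g)"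
  by (simp add: mscale_def Poly_Mapping.map.rep_eq when_def)

lemma mscale_eqI:
  "(\<And>g \<mu>. Poly_Mapping.lookup (Poly_Mapping.lookup v g) \<mu> = Poly_Mapping.lookup (Poly_Mapping.lookup w g) \<mu>) \<Longrightarrow> v = w"
  by (intro poly_mapping_eqI)

lemma mscale_add: "mscale c (v + w) = mscale c v + mscale c w"
  by (rule mscale_eqI) (simp add: lookup_add algebra_simps)

lemma mscale_add_left: "mscale (a + b) w = mscale a w + mscale b w"
  by (rule mscale_eqI) (simp add: lookup_add algebra_simps)

lemma mscale_mscale [simp]: "mscale a (mscale b w) = mscale (a * b) w"
  by (rule mscale_eqI) (simp add: algebra_simps)

lemma mscale_one [simp]: "mscale 1 w = w"
  by (rule mscale_eqI) simp

lemma mscale_zero [simp]: "mscale c 0 = 0"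
  by (rule mscale_eqI) simp

lemma mscale_zero_left [simp]: "mscale 0 w = 0"
  by (rule mscale_eqI) simp

lemma mscale_minus: "mscale (- c) w = - mscale c w"
  by (rule mscale_eqI) simp

lemma mscale_diff: "mscale c (v - w) = mscale c v - mscale c w"
  by (rule mscale_eqI) (simp add: lookup_minus algebra_simps)

lemma mscale_sum: "mscale c (sum f A) = (\<Sum>x\<in>A. mscale c (f x))"
  by (induction A rule: infinite_finite_induct) (simp_all add: mscale_add)

subsection \<open>The twisted group algebra\<close>

lemma cocyc_add_left: "cocyc (\<alpha> + \<beta>) \<gamma> = cocyc \<alpha> \<gamma> * cocyc \<beta> \<gamma>"
  unfolding cocyc_def
  by (simp add: prod.distrib[symmetric] power_int_add[symmetric] algebra_simps)

lemma cocyc_add_right: "cocyc \<alpha> (\<beta> + \<gamma>) = cocyc \<alpha> \<beta> * cocyc \<alpha> \<gamma>"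
  unfolding cocyc_def
  by (simp add: prod.distrib[symmetric] power_int_add[symmetric] algebra_simps)

lemma cocyc_eps: "cocyc (eps i) (eps j) = (if i \<le> j then 1 else -1)"
proof -
  have "cocyc (eps i) (eps j) = (\<Prod>k\<in>UNIV. \<Prod>l\<in>UNIV. if k = i \<and> l = j then (if i \<le> j then 1 else -1) else 1)"
    unfolding cocyc_def by (intro prod.cong refl) (auto simp: axis_def)
  also have "\<dots> = (\<Prod>k\<in>UNIV. if k = i then (if i \<le> j then 1 else -1) else 1)"
    by (intro prod.cong refl) (auto simp: prod.delta)
  finally show ?thesis by (auto simp: prod.delta)
qed

lemma cocyc_mod2: "red2 \<beta> = red2 \<gamma> \<Longrightarrow> cocyc \<alpha> \<beta> = cocyc \<alpha> \<gamma>"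
proof -
  assume "red2 \<beta> = red2 \<gamma>"
  hence "(of_int (\<beta> $ j) :: bit) = of_int (\<gamma> $ j)" for j
    by (auto simp: red2_def vec_eq_iff)
  hence ev: "even (\<beta> $ j) \<longleftrightarrow> even (\<gamma> $ j)" for j
    by (metis even_of_int_iff)
  show ?thesis unfolding cocyc_def
    proof (intro prod.cong refl)
    fix i j
    show "(if i \<le> j then 1 else - 1 :: complex) powi (\<alpha> $ i * \<beta> $ j) = (if i \<le> j then 1 else - 1) powi (\<alpha> $ i * \<gamma> $ j)"
      using ev[of j] by (cases "even (\<alpha> $ i * \<beta> $ j)") auto
  qed
qed

lemma red2_rep2 [simp]: "red2 (rep2 g) = g"
  by (auto simp: red2_def rep2_def vec_eq_iff)

lemma red2_add: "red2 (\<alpha> + \<beta>) = red2 \<alpha> + red2 \<beta>"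
  by (auto simp: red2_def vec_eq_iff)

lemma grp_op_single:
  "grp_op \<alpha> (Poly_Mapping.single (red2 \<beta>) s) = Poly_Mapping.single (red2 (\<alpha> + \<beta>)) (cscale (cocyc \<alpha> \<beta>) s)"
  using cocyc_mod2[of "rep2 (red2 \<beta>)" \<beta> \<alpha>]
  by (cases "s = 0") (simp_all add: grp_op_def red2_add)


subsection \<open>The Heisenberg action\<close>

lemma lookup_sym_deriv:
  "Poly_Mapping.lookup (sym_deriv v p) \<mu> =
     of_nat (Poly_Mapping.lookup \<mu> v + 1) * Poly_Mapping.lookup p (\<mu> + Poly_Mapping.single v 1)"
proof -
  have *: "(of_nat (Poly_Mapping.lookup \<nu> v) * Poly_Mapping.lookup p \<nu> when \<nu> - Poly_Mapping.single v 1 = \<mu>)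
      = (if \<nu> = \<mu> + Poly_Mapping.single v 1
         then of_nat (Poly_Mapping.lookup \<mu> v + 1) * Poly_Mapping.lookup p (\<mu> + Poly_Mapping.single v 1) else 0)" for \<nu>
  proof (cases "Poly_Mapping.lookup \<nu> v = 0")
    case True
    hence "\<nu> \<noteq> \<mu> + Poly_Mapping.single v 1" by (metis add_eq_0_iff_both_eq_0 lookup_add lookup_single_eq one_neq_zero)
    thus ?thesis using True by simp
  next
    case False
    have "\<nu> = (\<nu> - Poly_Mapping.single v 1) + Poly_Mapping.single v 1"
      using False by (intro poly_mapping_eqI) (auto simp: lookup_add lookup_minus lookup_single when_def)
    moreover have "(\<mu> + Poly_Mapping.single v 1) - Poly_Mapping.single v 1 = \<mu>"
      by (intro poly_mapping_eqI) (simp add: lookup_add lookup_minus)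
    ultimately have "\<nu> - Poly_Mapping.single v 1 = \<mu> \<longleftrightarrow> \<nu> = \<mu> + Poly_Mapping.single v 1"
      by metis
    thus ?thesis by (auto simp: lookup_add)
  qed
  show ?thesis
    unfolding sym_deriv_def lookup_sum lookup_single *
    by (auto simp: sum.delta in_keys_iff)
qed

lemma sym_deriv_var: "sym_deriv v (sym_var u) = (if u = v then 1 else 0)"
proof (rule poly_mapping_eqI)
  fix \<mu> :: "'a \<times> nat \<Rightarrow>\<^sub>0 nat"
  have "Poly_Mapping.single u 1 = \<mu> + Poly_Mapping.single v 1 \<longleftrightarrow> u = v \<and> \<mu> = 0"
  proof
    assume a: "Poly_Mapping.single u 1 = \<mu> + Poly_Mapping.single v 1"
    have "u = v" using arg_cong[OF a, of "\<lambda>p. Poly_Mapping.lookup p v"]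
      by (auto simp: lookup_add lookup_single when_def split: if_splits)
    with a show "u = v \<and> \<mu> = 0" by simp
  qed auto
  thus "Poly_Mapping.lookup (sym_deriv v (sym_var u)) \<mu> = Poly_Mapping.lookup (if u = v then 1 else 0) \<mu>"
    unfolding lookup_sym_deriv by (auto simp: sym_var_def lookup_single when_def lookup_one)
qed

lemma sym_deriv_add: "sym_deriv v (p + q) = sym_deriv v p + sym_deriv v q"
  by (rule poly_mapping_eqI) (simp add: lookup_sym_deriv lookup_add algebra_simps)

lemma sym_deriv_cscale: "sym_deriv v (cscale c p) = cscale c (sym_deriv v p)"
  by (rule poly_mapping_eqI) (simp add: lookup_sym_deriv)

lemma sym_deriv_zero [simp]: "sym_deriv v 0 = 0"
  by (rule poly_mapping_eqI) (simp add: lookup_sym_deriv)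

lemma sym_deriv_commute: "sym_deriv v (sym_deriv u p) = sym_deriv u (sym_deriv v p)"
  by (rule poly_mapping_eqI)
    (simp add: lookup_sym_deriv lookup_add lookup_single when_def algebra_simps)

lemma sum_single_keys: "(\<Sum>k\<in>Poly_Mapping.keys p. Poly_Mapping.single k (Poly_Mapping.lookup p k)) = p"
  by (rule poly_mapping_eqI) (auto simp: lookup_sum lookup_single when_def sum.delta in_keys_iff)

lemma pm_induct [case_names single add]:
  assumes s: "\<And>k c. P (Poly_Mapping.single k c)" and a: "\<And>p q. P p \<Longrightarrow> P q \<Longrightarrow> P (p + q)"
  shows "P (p :: 'a \<Rightarrow>\<^sub>0 'b::comm_monoid_add)"
proof -
  have "P 0" using s[of undefined 0] by simp
  hence "P (\<Sum>k\<in>A. Poly_Mapping.single k (Poly_Mapping.lookup p k))" for A :: "'a set"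
    by (induction A rule: infinite_finite_induct) (auto intro: s a)
  from this[of "Poly_Mapping.keys p"] show ?thesis by (simp add: sum_single_keys)
qed

lemma sym_deriv_single:
  "sym_deriv v (Poly_Mapping.single \<mu> c) = Poly_Mapping.single (\<mu> - Poly_Mapping.single v 1) (of_nat (Poly_Mapping.lookup \<mu> v) * c)"
  by (simp add: sym_deriv_def)

lemma sym_deriv_mult: "sym_deriv v (p * q) = sym_deriv v p * q + p * sym_deriv v q"
proof (induction p rule: pm_induct)
  case (single \<mu> c)
  show ?case
  proof (induction q rule: pm_induct)
    case (single \<nu> d)
    have 1: "(\<mu> - Poly_Mapping.single v 1) + \<nu> = \<mu> + \<nu> - Poly_Mapping.single v 1" if "Poly_Mapping.lookup \<mu> v \<noteq> 0"
      using that by (intro poly_mapping_eqI) (auto simp: lookup_add lookup_minus lookup_single when_def)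
    have 2: "\<mu> + (\<nu> - Poly_Mapping.single v 1) = \<mu> + \<nu> - Poly_Mapping.single v 1" if "Poly_Mapping.lookup \<nu> v \<noteq> 0"
      using that by (intro poly_mapping_eqI) (auto simp: lookup_add lookup_minus lookup_single when_def)
    have "sym_deriv v (Poly_Mapping.single \<mu> c) * Poly_Mapping.single \<nu> d
        = Poly_Mapping.single (\<mu> + \<nu> - Poly_Mapping.single v 1) (of_nat (Poly_Mapping.lookup \<mu> v) * c * d)"
      by (cases "Poly_Mapping.lookup \<mu> v = 0") (use 1 in \<open>simp_all add: sym_deriv_single mult_single\<close>)
    moreover have "Poly_Mapping.single \<mu> c * sym_deriv v (Poly_Mapping.single \<nu> d)
        = Poly_Mapping.single (\<mu> + \<nu> - Poly_Mapping.single v 1) (of_nat (Poly_Mapping.lookup \<nu> v) * (c * d))"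
      by (cases "Poly_Mapping.lookup \<nu> v = 0") (use 2 in \<open>simp_all add: sym_deriv_single mult_single mult.left_commute[of c]\<close>)
    ultimately show ?case
      by (simp add: mult_single sym_deriv_single single_add[symmetric] lookup_add algebra_simps)
  qed (simp add: sym_deriv_add algebra_simps)
qed (simp add: sym_deriv_add algebra_simps)

definition fock_linear :: "('n::finite fock \<Rightarrow> 'n fock) \<Rightarrow> bool" where
  "fock_linear f \<longleftrightarrow> (\<forall>v w. f (v + w) = f v + f w) \<and> (\<forall>a w. f (mscale a w) = mscale a (f w))"

lemma fock_linearI:
  "(\<And>v w. f (v + w) = f v + f w) \<Longrightarrow> (\<And>a w. f (mscale a w) = mscale a (f w)) \<Longrightarrow> fock_linear f"
  by (simp add: fock_linear_def)

lemma fock_linear_add: "fock_linear f \<Longrightarrow> f (v + w) = f v + f w"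
  and fock_linear_scale: "fock_linear f \<Longrightarrow> f (mscale a w) = mscale a (f w)"
  by (simp_all add: fock_linear_def)

lemma fock_linear_zero: "fock_linear f \<Longrightarrow> f 0 = 0"
  using fock_linear_scale[of f 0 0] by simp

lemma fock_linear_sum: "fock_linear f \<Longrightarrow> f (sum g A) = (\<Sum>x\<in>A. f (g x))"
  by (induction A rule: infinite_finite_induct) (simp_all add: fock_linear_add fock_linear_zero)

lemma lookup_heis:
  "Poly_Mapping.lookup (heis i n w) g =
     (if even n then 0
      else if n < 0 then sym_var (i, nat ((- n - 1) div 2)) * Poly_Mapping.lookup w g
      else cscale (of_int n / 2) (sym_deriv (i, nat ((n - 1) div 2)) (Poly_Mapping.lookup w g)))"
  by (simp add: heis_def Poly_Mapping.map.rep_eq when_def)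

lemma cscale_add: "cscale c (p + q) = cscale c p + cscale c q"
  by (rule poly_mapping_eqI) (simp add: lookup_add algebra_simps)

lemma cscale_cscale: "cscale c (cscale d p) = cscale (c * d) p"
  by (rule poly_mapping_eqI) (simp add: algebra_simps)

lemma cscale_mult_right: "p * cscale c q = cscale c (p * q)" for p q :: "'n::type sym"
  by (simp add: cscale_def mult_map_scale_conv_mult mult.left_commute)

lemma cscale_mult_left: "cscale c p * q = cscale c (p * q)" for p q :: "'n::type sym"
  by (simp add: cscale_def mult_map_scale_conv_mult mult.assoc)

lemma fock_linear_heis: "fock_linear (heis i n)"
proof (rule fock_linearI)
  show "heis i n (v + w) = heis i n v + heis i n w" for v w
    by (rule poly_mapping_eqI) (simp add: lookup_heis lookup_add algebra_simps sym_deriv_add cscale_add)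
  show "heis i n (mscale a w) = mscale a (heis i n w)" for a w
    by (rule poly_mapping_eqI)
      (auto simp: lookup_heis cscale_mult_right sym_deriv_cscale cscale_cscale mult.commute[of "of_int n"])
qed

lemma heis_bracket:
  assumes "odd m" "odd n"
  shows "heis i m (heis j n w) - heis j n (heis i m w) =
    mscale (if i = j \<and> m + n = 0 then of_int m / 2 else 0) w"
proof (rule poly_mapping_eqI)
  fix g
  have v: "(i, nat ((m - 1) div 2)) = (j, nat ((- n - 1) div 2)) \<longleftrightarrow> i = j \<and> m + n = 0" if "m > 0" "n < 0"
    using that assms by (auto elim!: oddE)
  have v': "(j, nat ((n - 1) div 2)) = (i, nat ((- m - 1) div 2)) \<longleftrightarrow> i = j \<and> m + n = 0" if "n > 0" "m < 0"
    using that assms by (auto elim!: oddE)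
  have mn: "m \<noteq> 0" "n \<noteq> 0" using assms by auto
  consider "m < 0" "n < 0" | "m > 0" "n > 0" | "m > 0" "n < 0" | "m < 0" "n > 0" using mn by linarith
  thus "Poly_Mapping.lookup (heis i m (heis j n w) - heis j n (heis i m w)) g =
    Poly_Mapping.lookup (mscale (if i = j \<and> m + n = 0 then of_int m / 2 else 0) w) g"
  proof cases
    case 1
    thus ?thesis using assms by (auto simp: lookup_minus lookup_heis algebra_simps intro!: poly_mapping_eqI)
  next
    case 2
    thus ?thesis using assms
      by (auto simp: lookup_minus lookup_heis sym_deriv_cscale cscale_cscale sym_deriv_commute mult.commute
          intro!: poly_mapping_eqI)
  next
    case 3
    thus ?thesis using assms v
      by (auto simp: lookup_minus lookup_heis sym_deriv_mult sym_deriv_var cscale_add cscale_mult_right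
          intro!: poly_mapping_eqI)
  next
    case 4
    have "m + n = 0 \<Longrightarrow> (of_int n :: complex) = - of_int m"
      by (metis add_eq_0_iff of_int_minus)
    thus ?thesis using assms v' 4
      by (auto simp: lookup_minus lookup_heis sym_deriv_mult sym_deriv_var cscale_add cscale_mult_right
          intro!: poly_mapping_eqI)
  qed
qed

subsection \<open>Local finiteness\<close>

definition wt :: "('n \<times> nat \<Rightarrow>\<^sub>0 nat) \<Rightarrow> nat" where
  "wt \<mu> = (\<Sum>v\<in>Poly_Mapping.keys \<mu>. (2 * snd v + 1) * Poly_Mapping.lookup \<mu> v)"

lemma wt_add: "wt (\<mu> + \<nu>) = wt \<mu> + wt \<nu>"
  unfolding wt_def by (rule setsum_keys_plus_distrib) (auto simp: algebra_simps)

lemma wt_single: "wt (Poly_Mapping.single v c) = (2 * snd v + 1) * c"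
  by (simp add: wt_def)

definition fil :: "int \<Rightarrow> 'n::finite fock \<Rightarrow> bool" where
  "fil d w \<longleftrightarrow> (\<forall>g \<mu>. Poly_Mapping.lookup (Poly_Mapping.lookup w g) \<mu> \<noteq> 0 \<longrightarrow> int (wt \<mu>) \<le> d)"

lemma fil_zero [simp]: "fil d 0"
  by (simp add: fil_def)

lemma fil_neg: "fil d w \<Longrightarrow> d < 0 \<Longrightarrow> w = 0"
  by (rule mscale_eqI) (force simp: fil_def)

lemma fil_add: "fil d v \<Longrightarrow> fil d w \<Longrightarrow> fil d (v + w)"
  unfolding fil_def lookup_add by (metis add.right_neutral)

lemma fil_scale: "fil d w \<Longrightarrow> fil d (mscale c w)"
  by (auto simp: fil_def)

lemma fil_sum: "(\<And>x. x \<in> A \<Longrightarrow> fil d (f x)) \<Longrightarrow> fil d (sum f A)"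
  by (induction A rule: infinite_finite_induct) (simp_all add: fil_add)

lemma fil_exists: "\<exists>d. fil d w"
proof -
  define S where "S = (\<Union>g\<in>Poly_Mapping.keys w. (\<lambda>\<mu>. int (wt \<mu>)) ` Poly_Mapping.keys (Poly_Mapping.lookup w g))"
  have "finite S" by (simp add: S_def)
  have "fil (Max S) w" unfolding fil_def
  proof (intro allI impI)
    fix g \<mu> assume a: "Poly_Mapping.lookup (Poly_Mapping.lookup w g) \<mu> \<noteq> 0"
    hence "Poly_Mapping.lookup w g \<noteq> 0" by auto
    with a have "int (wt \<mu>) \<in> S" by (force simp: S_def in_keys_iff)
    thus "int (wt \<mu>) \<le> Max S" using \<open>finite S\<close> by simp
  qed
  thus ?thesis ..
qed

lemma fil_heis: "fil d w \<Longrightarrow> n > 0 \<Longrightarrow> fil (d - n) (heis i n w)"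
proof (cases "even n")
  case False
  assume a: "fil d w" "n > 0"
  show ?thesis unfolding fil_def
  proof (intro allI impI)
    fix g \<mu> assume "Poly_Mapping.lookup (Poly_Mapping.lookup (heis i n w) g) \<mu> \<noteq> 0"
    hence "Poly_Mapping.lookup (Poly_Mapping.lookup w g) (\<mu> + Poly_Mapping.single (i, nat ((n - 1) div 2)) 1) \<noteq> 0"
      using a False by (simp add: lookup_heis lookup_sym_deriv)
    hence "int (wt (\<mu> + Poly_Mapping.single (i, nat ((n - 1) div 2)) 1)) \<le> d"
      using a(1) by (simp add: fil_def)
    thus "int (wt \<mu>) \<le> d - n"
      using False a(2) by (auto simp: wt_add wt_single algebra_simps elim!: oddE)
  qed
qed (simp add: heis_def)

definition lowers :: "'n::finite opser \<Rightarrow> bool" where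
  "lowers A \<longleftrightarrow> (\<forall>d w k. fil d w \<longrightarrow> fil (d - int k) (A k w))"

lemma lowers_mult: "lowers A \<Longrightarrow> lowers B \<Longrightarrow> lowers (os_mult A B)"
  unfolding lowers_def os_mult_def
proof (intro allI impI fil_sum)
  fix d :: int and w :: "'a fock" and k l :: nat
  assume A: "\<forall>d w k. fil d w \<longrightarrow> fil (d - int k) (A k w)" and B: "\<forall>d w k. fil d w \<longrightarrow> fil (d - int k) (B k w)"
    and w: "fil d w" and l: "l \<in> {..k}"
  have "fil (d - int (k - l) - int l) (A l (B (k - l) w))" using A B w by blast
  thus "fil (d - int k) (A l (B (k - l) w))" using l by (simp add: of_nat_diff)
qed

lemma lowers_pow: "lowers A \<Longrightarrow> lowers (os_pow A r)"
proof (induction r)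
  case 0
  show ?case by (simp add: lowers_def os_one_def)
qed (simp add: lowers_mult)

lemma lowers_exp: "lowers A \<Longrightarrow> lowers (os_exp A)"
  using lowers_pow[of A] unfolding lowers_def os_exp_def by (blast intro: fil_sum fil_scale)

lemma lowers_dilate: "lowers A \<Longrightarrow> lowers (os_dilate a A)"
  unfolding lowers_def os_dilate_def by (blast intro: fil_scale)

lemma lowers_Eplus: "lowers (Eplus \<alpha>)"
  unfolding Eplus_def
proof (rule lowers_exp, unfold lowers_def, intro allI impI)
  fix d :: int and k :: nat and w :: "'a fock" assume "fil d w"
  thus "fil (d - int k) (if odd k then mscale (- 2 / of_int (int k)) (heis_lat \<alpha> (int k) w) else 0)"
    by (cases "odd k") (auto simp: heis_lat_def intro!: fil_scale fil_sum fil_heis elim!: oddE)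
qed

lemma fock_linear_mscale: "fock_linear (mscale c)"
  by (rule fock_linearI) (simp_all add: mscale_add mult.commute)

lemma fock_linear_compose: "fock_linear f \<Longrightarrow> fock_linear g \<Longrightarrow> fock_linear (\<lambda>w. f (g w))"
  by (simp add: fock_linear_def)

lemma fock_linear_sum_fun: "(\<And>x. x \<in> A \<Longrightarrow> fock_linear (f x)) \<Longrightarrow> fock_linear (\<lambda>w. \<Sum>x\<in>A. f x w)"
  by (rule fock_linearI) (simp_all add: fock_linear_def sum.distrib mscale_sum cong: sum.cong)

lemma fock_linear_id: "fock_linear (\<lambda>w. w)" and fock_linear_const0: "fock_linear (\<lambda>w. 0)"
  by (simp_all add: fock_linear_def)

lemma fock_linear_heis_lat: "fock_linear (heis_lat \<alpha> n)"
  unfolding heis_lat_def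
  by (intro fock_linear_sum_fun fock_linear_compose[OF fock_linear_mscale] fock_linear_heis)

lemma fock_linear_os_mult: "(\<And>k. fock_linear (A k)) \<Longrightarrow> (\<And>k. fock_linear (B k)) \<Longrightarrow> fock_linear (os_mult A B k)"
  unfolding os_mult_def by (intro fock_linear_sum_fun) (rule fock_linear_compose; blast)

lemma fock_linear_os_pow: "(\<And>k. fock_linear (A k)) \<Longrightarrow> fock_linear (os_pow A r k)"
proof (induction r arbitrary: k)
  case 0
  show ?case by (cases "k = 0") (simp_all add: os_one_def fock_linear_def)
qed (auto intro: fock_linear_os_mult)

lemma fock_linear_os_exp: "(\<And>k. fock_linear (A k)) \<Longrightarrow> fock_linear (os_exp A k)"
  unfolding os_exp_def
  by (intro fock_linear_sum_fun fock_linear_compose[OF fock_linear_mscale] fock_linear_os_pow)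

lemma fock_linear_os_dilate: "(\<And>k. fock_linear (A k)) \<Longrightarrow> fock_linear (os_dilate a A k)"
  unfolding os_dilate_def by (intro fock_linear_compose[OF fock_linear_mscale])

lemma fock_linear_Eminus: "fock_linear (Eminus \<alpha> k)"
  unfolding Eminus_def
proof (rule fock_linear_os_exp)
  show "fock_linear (\<lambda>w. if odd k then mscale (- 2 / of_int (- int k)) (heis_lat \<alpha> (- int k) w) else 0)" for k
    by (cases "odd k") (simp_all add: fock_linear_const0 fock_linear_compose[OF fock_linear_mscale fock_linear_heis_lat])
qed

lemma fock_linear_Eplus: "fock_linear (Eplus \<alpha> k)"
  unfolding Eplus_def
proof (rule fock_linear_os_exp)
  show "fock_linear (\<lambda>w. if odd k then mscale (- 2 / of_int (int k)) (heis_lat \<alpha> (int k) w) else 0)" for k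
    by (cases "odd k") (simp_all add: fock_linear_const0 fock_linear_compose[OF fock_linear_mscale fock_linear_heis_lat])
qed

lemma fock_linear_Eminus2: "fock_linear (Eminus2 i j a p)"
  unfolding Eminus2_def by (intro fock_linear_os_mult fock_linear_os_dilate fock_linear_Eminus)

lemma fock_linear_Eplus2: "fock_linear (Eplus2 i j a p)"
  unfolding Eplus2_def by (intro fock_linear_os_mult fock_linear_os_dilate fock_linear_Eplus)

lemma vertex_summands_finite:
  "finite {(p, q). (if int q - int p = n then Eminus2 i j a p (Eplus2 i j a q w) else 0) \<noteq> 0}"
proof -
  have low: "lowers (Eplus2 i j a)"
    unfolding Eplus2_def by (intro lowers_mult lowers_dilate lowers_Eplus)
  obtain d where d: "fil d w" using fil_exists by blast
  have z: "Eplus2 i j a q w = 0" if "int q > d" for q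
    by (rule fil_neg[of "d - int q"]) (use low d that in \<open>auto simp: lowers_def\<close>)
  have lin0: "Eminus2 i j a p 0 = 0" for p
    by (rule fock_linear_zero[OF fock_linear_Eminus2])
  have "{(p, q). (if int q - int p = n then Eminus2 i j a p (Eplus2 i j a q w) else 0) \<noteq> 0}
      \<subseteq> (\<lambda>q. (nat (int q - n), q)) ` {q. int q \<le> d}"
  proof clarify
    fix p q assume "(if int q - int p = n then Eminus2 i j a p (Eplus2 i j a q w) else 0) \<noteq> 0"
    hence "p = nat (int q - n)" "Eminus2 i j a p (Eplus2 i j a q w) \<noteq> 0" by (auto split: if_splits)
    moreover from this have "int q \<le> d" using z[of q] lin0[of p] by (cases "int q \<le> d") auto
    ultimately have "p = nat (int q - n)" "int q \<le> d" by auto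
    thus "(p, q) \<in> (\<lambda>q. (nat (int q - n), q)) ` {q. int q \<le> d}" by blast
  qed
  moreover have "finite {q. int q \<le> d}"
    by (rule finite_subset[of _ "{..nat d}"]) auto
  ultimately show ?thesis using finite_surj by blast
qed

subsection \<open>The algebra \<open>R\<^sub>\<sigma>\<close> and the bracket\<close>

lemma lext_add:
  fixes f :: "'k \<Rightarrow> 'b::comm_monoid_add \<Rightarrow> 'c::comm_monoid_add"
  assumes "\<And>k. f k 0 = 0" "\<And>k a b. f k (a + b) = f k a + f k b"
  shows "(\<Sum>k\<in>Poly_Mapping.keys (p + q). f k (Poly_Mapping.lookup (p + q) k)) =
    (\<Sum>k\<in>Poly_Mapping.keys p. f k (Poly_Mapping.lookup p k)) + (\<Sum>k\<in>Poly_Mapping.keys q. f k (Poly_Mapping.lookup q k))"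
  by (rule setsum_keys_plus_distrib) (use assms in auto)

lemma character_props:
  assumes "character \<sigma>"
  shows character_nz: "\<sigma> \<alpha> \<noteq> 0" and character_add: "\<sigma> (\<alpha> + \<beta>) = \<sigma> \<alpha> * \<sigma> \<beta>"
    and character_diff: "\<sigma> (\<alpha> - \<beta>) = \<sigma> \<alpha> / \<sigma> \<beta>"
    and character_zero: "\<sigma> 0 = 1" and character_minus: "\<sigma> (- \<alpha>) = inverse (\<sigma> \<alpha>)"
proof -
  show nz: "\<sigma> \<alpha> \<noteq> 0" for \<alpha> using assms by (simp add: character_def)
  show ad: "\<sigma> (\<alpha> + \<beta>) = \<sigma> \<alpha> * \<sigma> \<beta>" for \<alpha> \<beta> using assms by (simp add: character_def)
  show z: "\<sigma> 0 = 1" using ad[of 0 0] nz[of 0] by simp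
  show "\<sigma> (\<alpha> - \<beta>) = \<sigma> \<alpha> / \<sigma> \<beta>" using ad[of "\<alpha> - \<beta>" \<beta>] nz[of \<beta>] by simp
  show "\<sigma> (- \<alpha>) = inverse (\<sigma> \<alpha>)" using ad[of \<alpha> "- \<alpha>"] z inverse_unique by force
qed

lemma rmult_single:
  "rmult \<sigma> (Poly_Mapping.single (m, \<alpha>) a) (Poly_Mapping.single (n, \<beta>) b) =
     Poly_Mapping.single (m + n, \<alpha> + \<beta>) (a * b * \<sigma> \<alpha> powi n)"
  by (cases "a = 0"; cases "b = 0") (simp_all add: rmult_def)

lemma rmult_alt: "rmult \<sigma> p q = (\<Sum>k\<in>Poly_Mapping.keys p. \<Sum>l\<in>Poly_Mapping.keys q.
     Poly_Mapping.single (fst k + fst l, snd k + snd l)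
       (Poly_Mapping.lookup p k * Poly_Mapping.lookup q l * \<sigma> (snd k) powi (fst l)))"
  by (simp add: rmult_def case_prod_unfold)

lemma rmult_add_left: "rmult \<sigma> (p + q) r = rmult \<sigma> p r + rmult \<sigma> q r"
  unfolding rmult_alt
  by (rule lext_add[where f = "\<lambda>k a. \<Sum>l\<in>Poly_Mapping.keys r.
     Poly_Mapping.single (fst k + fst l, snd k + snd l) (a * Poly_Mapping.lookup r l * \<sigma> (snd k) powi (fst l))"])
    (simp_all add: sum.distrib[symmetric] single_add[symmetric] algebra_simps)

lemma rmult_add_right: "rmult \<sigma> r (p + q) = rmult \<sigma> r p + rmult \<sigma> r q"
proof -
  have "(\<Sum>l\<in>Poly_Mapping.keys (p + q).
     Poly_Mapping.single (fst k + fst l, snd k + snd l)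
       (Poly_Mapping.lookup r k * Poly_Mapping.lookup (p + q) l * \<sigma> (snd k) powi (fst l))) =
   (\<Sum>l\<in>Poly_Mapping.keys p.
     Poly_Mapping.single (fst k + fst l, snd k + snd l)
       (Poly_Mapping.lookup r k * Poly_Mapping.lookup p l * \<sigma> (snd k) powi (fst l))) +
   (\<Sum>l\<in>Poly_Mapping.keys q.
     Poly_Mapping.single (fst k + fst l, snd k + snd l)
       (Poly_Mapping.lookup r k * Poly_Mapping.lookup q l * \<sigma> (snd k) powi (fst l)))" for k
    by (rule lext_add[where f = "\<lambda>l b. Poly_Mapping.single (fst k + fst l, snd k + snd l)
       (Poly_Mapping.lookup r k * b * \<sigma> (snd k) powi (fst l))"])
      (simp_all add: single_add[symmetric] algebra_simps)
  thus ?thesis unfolding rmult_alt by (simp add: sum.distrib)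
qed

lemma rmult_zero [simp]: "rmult \<sigma> 0 q = 0" "rmult \<sigma> p 0 = 0"
  by (simp_all add: rmult_def)

lemma rbar_single:
  "rbar \<sigma> (Poly_Mapping.single (m, \<alpha>) a) = Poly_Mapping.single (m, - \<alpha>) (a * (-1) powi m * \<sigma> (- \<alpha>) powi m)"
  by (cases "a = 0") (simp_all add: rbar_def)

lemma rbar_add: "rbar \<sigma> (p + q) = rbar \<sigma> p + rbar \<sigma> q"
  unfolding rbar_def case_prod_unfold
  using lext_add[where f = "\<lambda>k a. Poly_Mapping.single (fst k, - snd k) (a * (-1) powi fst k * \<sigma> (- snd k) powi fst k)"]
  by (simp add: single_add[symmetric] algebra_simps)

lemma rbar_zero [simp]: "rbar \<sigma> 0 = 0"
  by (simp add: rbar_def)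

lemma rmult_assoc:
  assumes "character \<sigma>"
  shows "rmult \<sigma> (rmult \<sigma> p q) r = rmult \<sigma> p (rmult \<sigma> q r)"
proof (induction p rule: pm_induct)
  case (single k a)
  show ?case
  proof (induction q rule: pm_induct)
    case (single l b)
    show ?case
    proof (induction r rule: pm_induct)
      case (single h c)
      show ?case
        by (cases k; cases l; cases h)
          (simp add: rmult_single character_add[OF assms] power_int_mult_distrib power_int_add
            character_nz[OF assms] algebra_simps)
    qed (simp add: rmult_add_right)
  qed (simp add: rmult_add_right rmult_add_left)
qed (simp add: rmult_add_left)

lemma rbar_rmult:
  assumes "character \<sigma>"
  shows "rbar \<sigma> (rmult \<sigma> p q) = rmult \<sigma> (rbar \<sigma> q) (rbar \<sigma> p)"
proof (induction p rule: pm_induct)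
  case (single k a)
  show ?case
  proof (induction q rule: pm_induct)
    case (single l b)
    show ?case
      by (cases k; cases l)
        (simp add: rmult_single rbar_single character_add[OF assms] character_minus[OF assms] character_diff[OF assms] power_int_mult_distrib
            power_int_add power_int_divide_distrib power_int_inverse character_nz[OF assms] field_simps)
  qed (simp add: rmult_add_right rmult_add_left rbar_add)
qed (simp add: rmult_add_left rmult_add_right rbar_add)

lemma rbar_rbar:
  assumes "character \<sigma>"
  shows "rbar \<sigma> (rbar \<sigma> p) = p"
proof (induction p rule: pm_induct)
  case (single k a)
  show ?case
    by (cases k) (simp add: rbar_single character_minus[OF assms] power_int_inverse character_nz[OF assms] field_simps)
qed (simp add: rbar_add)

lemma rbar_gens:
  "rbar \<sigma> (Poly_Mapping.single (1, 0) 1) = - Poly_Mapping.single (1, 0) (\<sigma> 0)"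
  "rbar \<sigma> (Poly_Mapping.single (0, \<alpha>) 1) = Poly_Mapping.single (0, - \<alpha>) 1"
  by (simp_all add: rbar_single single_uminus[symmetric])

text \<open>\<open>E\<^sub>i\<^sub>j t\<^sup>m e\<^sup>\<alpha>\<close>\<close>

abbreviation e_mat :: "'n::finite \<Rightarrow> 'n \<Rightarrow> int \<Rightarrow> 'g \<Rightarrow> ('n, 'g) ghat" where
  "e_mat i j m \<alpha> \<equiv> (mat_unit i j (Poly_Mapping.single (m, \<alpha>) 1), 0)"

lemma gl_mult_mat_unit:
  "gl_mult \<sigma> (mat_unit i j p) (mat_unit k l q) = (if j = k then mat_unit i l (rmult \<sigma> p q) else 0)"
proof -
  have "(\<Sum>x\<in>UNIV. rmult \<sigma> (if a = i \<and> x = j then p else 0) (if x = k \<and> b = l then q else 0)) =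
    (\<Sum>x\<in>UNIV. if x = j then (if a = i \<and> j = k \<and> b = l then rmult \<sigma> p q else 0) else 0)" for a b
    by (intro sum.cong) auto
  thus ?thesis by (auto simp: gl_mult_def mat_unit_def vec_eq_iff sum.delta)
qed

lemma hat_scale_simp: "hat_scale c (X, z) = ((\<chi> i j. cscale c (X $ i $ j)), c * z)"
  by (simp add: hat_scale_def)

lemma gl_cocycle_basis:
  "gl_cocycle \<sigma> (mat_unit i j (Poly_Mapping.single (m, \<alpha>) 1)) (mat_unit k l (Poly_Mapping.single (n, \<beta>) 1)) =
     (if i = l \<and> j = k \<and> m + n = 0 \<and> \<sigma> \<alpha> * \<sigma> \<beta> = 1 then of_int m * \<sigma> \<alpha> powi n else 0)"
proof -
  have "gl_cocycle \<sigma> (mat_unit i j (Poly_Mapping.single (m, \<alpha>) 1)) (mat_unit k l (Poly_Mapping.single (n, \<beta>) 1)) =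
    (\<Sum>x\<in>UNIV. \<Sum>y\<in>UNIV. if y = j then (if x = i then
       (if i = l \<and> j = k \<and> m + n = 0 \<and> \<sigma> \<alpha> * \<sigma> \<beta> = 1 then of_int m * \<sigma> \<alpha> powi n else 0) else 0) else 0)"
    unfolding gl_cocycle_def by (intro sum.cong refl) (auto simp: mat_unit_def)
  also have "\<dots> = (\<Sum>x\<in>UNIV. if x = i then
       (if i = l \<and> j = k \<and> m + n = 0 \<and> \<sigma> \<alpha> * \<sigma> \<beta> = 1 then of_int m * \<sigma> \<alpha> powi n else 0) else 0)"
    by (intro sum.cong refl) (auto simp: sum.delta)
  finally show ?thesis by (simp add: sum.delta)
qed

lemma hat_bracket_basis:
  fixes i :: "'n::finite" and \<alpha> :: "'g::ab_group_add"
  shows "hat_bracket \<sigma> (e_mat i j m \<alpha>) (e_mat k l n \<beta>) =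
     (if j = k then hat_scale (\<sigma> \<alpha> powi n) (e_mat i l (m + n) (\<alpha> + \<beta>)) else 0)
     - (if i = l then hat_scale (\<sigma> \<beta> powi m) (e_mat k j (m + n) (\<alpha> + \<beta>)) else 0)
     + (if i = l \<and> j = k \<and> m + n = 0 \<and> \<sigma> \<alpha> * \<sigma> \<beta> = 1
        then hat_scale (of_int m * \<sigma> \<alpha> powi n) hat_c else 0)"
proof -
  have hs: "hat_scale c (e_mat i j m \<alpha>) = (mat_unit i j (Poly_Mapping.single (m, \<alpha>) c), 0)"
    for c i m and j :: "'n::finite" and \<alpha> :: "'g::ab_group_add"
    by (auto simp: hat_scale_def mat_unit_def vec_eq_iff)
  have hc: "hat_scale c (hat_c :: ('n::finite, 'g::ab_group_add) ghat) = (0, c)" for c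
    by (auto simp: hat_scale_def hat_c_def vec_eq_iff)
  show ?thesis
    unfolding hat_bracket_def fst_conv snd_conv gl_mult_mat_unit rmult_single gl_cocycle_basis hs hc
      add.commute[of n m] add.commute[of \<beta> \<alpha>]
    by (cases "j = k"; cases "i = l"; cases "m + n = 0 \<and> \<sigma> \<alpha> * \<sigma> \<beta> = 1")
      (auto simp: prod_eq_iff)
qed

subsection \<open>Existence of the conjugate anti-involution\<close>

definition rdag :: "('g::ab_group_add \<Rightarrow> complex) \<Rightarrow> 'g rsig \<Rightarrow> 'g rsig" where
  "rdag \<sigma> p = (\<Sum>k\<in>Poly_Mapping.keys p.
     Poly_Mapping.single (- fst k, - snd k) (cnj (Poly_Mapping.lookup p k) * \<sigma> (snd k) powi fst k))"

lemma rdag_single: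
  "rdag \<sigma> (Poly_Mapping.single (m, \<alpha>) a) = Poly_Mapping.single (- m, - \<alpha>) (cnj a * \<sigma> \<alpha> powi m)"
  by (cases "a = 0") (simp_all add: rdag_def)

lemma rdag_add: "rdag \<sigma> (p + q) = rdag \<sigma> p + rdag \<sigma> q"
  unfolding rdag_def
  using lext_add[where f = "\<lambda>k a. Poly_Mapping.single (- fst k, - snd k) (cnj a * \<sigma> (snd k) powi fst k)"]
  by (simp add: single_add[symmetric] algebra_simps)

lemma rdag_zero [simp]: "rdag \<sigma> 0 = 0"
  by (simp add: rdag_def)

lemma rdag_uminus: "rdag \<sigma> (- p) = - rdag \<sigma> p"
  using rdag_add[of \<sigma> p "- p"] by (simp add: add_eq_0_iff)

lemma rbar_uminus: "rbar \<sigma> (- p) = - rbar \<sigma> p"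
  using rbar_add[of \<sigma> p "- p"] by (simp add: add_eq_0_iff)

lemma rdag_cscale: "rdag \<sigma> (cscale c p) = cscale (cnj c) (rdag \<sigma> p)"
proof (induction p rule: pm_induct)
  case (single k a) show ?case by (cases k) (simp add: rdag_single mult.assoc)
qed (simp add: rdag_add cscale_add)

lemma rdag_rbar:
  assumes "character \<sigma>" "\<And>\<alpha>. cmod (\<sigma> \<alpha>) = 1"
  shows "rdag \<sigma> (rbar \<sigma> p) = rbar \<sigma> (rdag \<sigma> p)"
proof (induction p rule: pm_induct)
  case (single k a)
  have cnj: "cnj (\<sigma> \<alpha>) = inverse (\<sigma> \<alpha>)" for \<alpha>
    using assms(2)[of \<alpha>] by (simp add: inverse_complex_def complex_eq_iff cmod_def)
  have inv: "inverse ((- 1 :: complex) powi m) = (- 1) powi m" for m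
    by (metis power_int_minus power_int_minus_one_minus)
  have canc: "\<sigma> \<beta> powi m * (z * inverse (\<sigma> \<beta> powi m)) = z" for \<beta> m z
    using character_nz[OF assms(1), of \<beta>] by (simp add: field_simps)
  show ?case
    by (cases k) (simp add: rdag_single rbar_single character_minus[OF assms(1)] cnj
        power_int_inverse power_int_minus inv character_nz[OF assms(1)] mult.assoc canc)
qed (simp add: rdag_add rbar_add)

definition tau_dag :: "('g::ab_group_add \<Rightarrow> complex) \<Rightarrow> ('n::finite, 'g) ghat \<Rightarrow> ('n, 'g) ghat" where
  "tau_dag \<sigma> x = ((\<chi> i j. rdag \<sigma> (fst x $ j $ i)), cnj (snd x))"

lemma tau_exists:
  fixes \<sigma> :: "'g::ab_group_add \<Rightarrow> complex"
  assumes "character \<sigma>" "\<And>\<alpha>. cmod (\<sigma> \<alpha>) = 1"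
  shows "conj_linear_on (u_hat \<sigma>) (tau_dag \<sigma>)"
    and "tau_dag \<sigma> (e_gen \<sigma> i j m \<alpha>) = hat_scale ((-1) powi (m + 1)) (e_gen \<sigma> i j (- m) \<alpha>)"
    and "tau_dag \<sigma> hat_c = hat_c"
proof -
  show "conj_linear_on (u_hat \<sigma>) (tau_dag \<sigma>)"
    unfolding conj_linear_on_def
    by (auto simp: u_hat_def tau_dag_def gl_star_def vec_eq_iff rdag_rbar[OF assms, symmetric] rdag_uminus[symmetric]
        rdag_add hat_scale_def rdag_cscale)
  show "tau_dag \<sigma> hat_c = hat_c"
    by (simp add: tau_dag_def hat_c_def vec_eq_iff)
  have cnj: "cnj (\<sigma> \<alpha>) = inverse (\<sigma> \<alpha>)"
    using assms(2)[of \<alpha>] by (simp add: inverse_complex_def complex_eq_iff cmod_def)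
  show "tau_dag \<sigma> (e_gen \<sigma> i j m \<alpha>) = hat_scale ((-1) powi (m + 1)) (e_gen \<sigma> i j (- m) \<alpha>)"
  proof -
    define s where "s k = Poly_Mapping.single (k, \<alpha>) (1::complex)" for k :: int
    have diff: "rdag \<sigma> (p - q) = rdag \<sigma> p - rdag \<sigma> q" for p q
      using rdag_add[of \<sigma> p "- q"] by (simp add: rdag_uminus)
    have cdiff: "cscale c (p - q) = cscale c p - cscale c q" for c and p q :: "'g rsig"
      by (rule poly_mapping_eqI) (simp add: lookup_minus algebra_simps)
    have 1: "(\<chi> a b. rdag \<sigma> ((mat_unit i j p - mat_unit j i q) $ b $ a)) = mat_unit j i (rdag \<sigma> p) - mat_unit i j (rdag \<sigma> q)"
      for p q
    proof -
      have "rdag \<sigma> ((mat_unit i j p - mat_unit j i q) $ b $ a) = (mat_unit j i (rdag \<sigma> p) - mat_unit i j (rdag \<sigma> q)) $ a $ b" for a b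
        by (cases "a = i"; cases "a = j"; cases "b = i"; cases "b = j") (simp_all only: mat_unit_def vector_minus_component vec_lambda_beta diff rdag_zero if_True if_False simp_thms)
      thus ?thesis by (simp only: vec_eq_iff vec_lambda_beta simp_thms)
    qed
    have 2: "(\<chi> a b. cscale c ((mat_unit i j p - mat_unit j i q) $ a $ b)) = mat_unit i j (cscale c p) - mat_unit j i (cscale c q)"
      for c and p q :: "'g rsig"
    proof -
      have "cscale c ((mat_unit i j p - mat_unit j i q) $ a $ b) = (mat_unit i j (cscale c p) - mat_unit j i (cscale c q)) $ a $ b" for a b
        by (cases "a = i"; cases "a = j"; cases "b = i"; cases "b = j") (simp_all only: mat_unit_def vector_minus_component vec_lambda_beta cdiff cscale_zero if_True if_False simp_thms)
      thus ?thesis by (simp only: vec_eq_iff vec_lambda_beta simp_thms)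
    qed
    have 3: "mat_unit j i (- p) - mat_unit i j (- q) = mat_unit i j q - mat_unit j i p" for p q :: "'g rsig"
    proof -
      have "(mat_unit j i (- p) - mat_unit i j (- q)) $ a $ b = (mat_unit i j q - mat_unit j i p) $ a $ b" for a b
        by (cases "a = i"; cases "a = j"; cases "b = i"; cases "b = j") (auto simp only: mat_unit_def vector_minus_component vec_lambda_beta  if_True if_False simp_thms diff_minus_eq_add add.commute[of "- p"] add_uminus_conv_diff add_0_left add_0_right minus_diff_eq diff_0 diff_0_right minus_minus)
      thus ?thesis by (simp only: vec_eq_iff simp_thms)
    qed
    have nz': "\<sigma> \<alpha> powi m * inverse (\<sigma> \<alpha> powi m) = 1"
      using character_nz[OF assms(1), of \<alpha>] by simp
    have sgn: "(- 1 :: complex) powi (m + 1) = - ((- 1) powi m)"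
      by (simp add: power_int_add)
    have sq: "(- 1 :: complex) powi m * (inverse ((- 1) powi m) * z) = z" for z
      by (simp add: mult.assoc[symmetric])
    have A: "rdag \<sigma> (s m) = - cscale ((- 1) powi (m + 1)) (rbar \<sigma> (s (- m)))"
      by (simp add: s_def sgn rdag_single rbar_single character_minus[OF assms(1)] power_int_inverse power_int_minus
          single_uminus[symmetric] sq)
    have B: "rdag \<sigma> (rbar \<sigma> (s m)) = - cscale ((- 1) powi (m + 1)) (s (- m))"
      by (simp add: s_def sgn nz' mult.assoc rdag_single rbar_single character_minus[OF assms(1)] power_int_inverse cnj
          single_uminus[symmetric])
    show ?thesis
      unfolding tau_dag_def e_gen_def hat_scale_def fst_conv snd_conv s_def[symmetric] 1 2 A B 3 by simp
  qed
qed

subsection \<open>Existence of the action\<close>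

definition commutes :: "('n::finite fock \<Rightarrow> 'n fock) \<Rightarrow> 'n opser \<Rightarrow> bool" where
  "commutes B A \<longleftrightarrow> (\<forall>k w. A k (B w) = B (A k w))"

lemma commutes_mult: "fock_linear B \<Longrightarrow> commutes B A \<Longrightarrow> commutes B A' \<Longrightarrow> commutes B (os_mult A A')"
  by (simp add: commutes_def os_mult_def fock_linear_sum)

lemma commutes_pow: "fock_linear B \<Longrightarrow> commutes B A \<Longrightarrow> commutes B (os_pow A r)"
proof (induction r)
  case 0 thus ?case by (simp add: commutes_def os_one_def fock_linear_zero)
qed (simp add: commutes_mult)

lemma commutes_exp: "fock_linear B \<Longrightarrow> commutes B A \<Longrightarrow> commutes B (os_exp A)"
  using commutes_pow[of B A] by (simp add: commutes_def os_exp_def fock_linear_sum fock_linear_scale)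

lemma heis_commute:
  assumes "m + n \<noteq> 0"
  shows "heis i m (heis j n w) = heis j n (heis i m w)"
proof (cases "even m \<or> even n")
  case True
  have "even l \<Longrightarrow> heis k l v = 0" for k l and v :: "'a fock" by (simp add: heis_def)
  thus ?thesis using True fock_linear_zero[OF fock_linear_heis] by auto
next
  case False
  thus ?thesis using heis_bracket[of m n i j w] assms by simp
qed

lemma heis_lat_commute: "m + n \<noteq> 0 \<Longrightarrow> heis_lat \<alpha> m (heis_lat \<beta> n w) = heis_lat \<beta> n (heis_lat \<alpha> m w)"
  unfolding heis_lat_def fock_linear_sum[OF fock_linear_heis] fock_linear_scale[OF fock_linear_heis] mscale_sum mscale_mscale
  by (subst sum.swap) (simp add: heis_commute mult.commute)

lemma Eminus_commute: "Eminus \<alpha> k (Eminus \<beta> l w) = Eminus \<beta> l (Eminus \<alpha> k w)"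
proof -
  have "commutes (heis_lat \<beta> (- int l)) (Eminus \<alpha>)" if "odd l" for l
    unfolding Eminus_def using that
    by (intro commutes_exp fock_linear_heis_lat)
      (auto simp: commutes_def fock_linear_scale[OF fock_linear_heis_lat] fock_linear_zero[OF fock_linear_heis_lat]
        heis_lat_commute elim!: oddE)
  hence "commutes (Eminus \<alpha> k) (Eminus \<beta>)"
    unfolding Eminus_def[of \<beta>]
    by (intro commutes_exp fock_linear_Eminus)
      (auto simp: commutes_def fock_linear_scale[OF fock_linear_Eminus] fock_linear_zero[OF fock_linear_Eminus])
  thus ?thesis by (simp add: commutes_def)
qed

lemma Eplus_commute: "Eplus \<alpha> k (Eplus \<beta> l w) = Eplus \<beta> l (Eplus \<alpha> k w)"
proof -
  have "commutes (heis_lat \<beta> (int l)) (Eplus \<alpha>)" if "odd l" for l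
    unfolding Eplus_def using that
    by (intro commutes_exp fock_linear_heis_lat)
      (auto simp: commutes_def fock_linear_scale[OF fock_linear_heis_lat] fock_linear_zero[OF fock_linear_heis_lat]
        heis_lat_commute elim!: oddE)
  hence "commutes (Eplus \<alpha> k) (Eplus \<beta>)"
    unfolding Eplus_def[of \<beta>]
    by (intro commutes_exp fock_linear_Eplus)
      (auto simp: commutes_def fock_linear_scale[OF fock_linear_Eplus] fock_linear_zero[OF fock_linear_Eplus])
  thus ?thesis by (simp add: commutes_def)
qed

lemma os_mult_dilate:
  assumes "\<And>k. fock_linear (A k)"
  shows "os_mult (os_dilate c A) (os_dilate c B) = os_dilate c (os_mult A B)"
proof (intro ext)
  fix k w
  have "mscale (c ^ l) (A l (mscale (c ^ (k - l)) (B (k - l) w))) = mscale (c ^ k) (A l (B (k - l) w))" if "l \<le> k" for l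
    using that by (simp add: fock_linear_scale[OF assms] power_add[symmetric])
  thus "os_mult (os_dilate c A) (os_dilate c B) k w = os_dilate c (os_mult A B) k w"
    by (simp add: os_mult_def os_dilate_def mscale_sum)
qed

lemma os_pow_dilate:
  assumes "\<And>k. fock_linear (A k)"
  shows "os_pow (os_dilate c A) r = os_dilate c (os_pow A r)"
proof (induction r)
  case 0
  show ?case by (intro ext) (simp add: os_one_def os_dilate_def)
qed (simp add: os_mult_dilate[OF assms])

lemma os_exp_dilate:
  assumes "\<And>k. fock_linear (A k)"
  shows "os_exp (os_dilate c A) = os_dilate c (os_exp A)"
  by (intro ext) (simp add: os_exp_def os_pow_dilate[OF assms] os_dilate_def mscale_sum mult.commute)

lemma heis_lat_minus: "heis_lat (- \<alpha>) n w = - heis_lat \<alpha> n w"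
  by (simp add: heis_lat_def mscale_minus sum_negf)

lemma Eminus_minus: "Eminus (- \<alpha>) k w = mscale ((- 1) ^ k) (Eminus \<alpha> k w)"
proof -
  have "(\<lambda>k w. if odd k then mscale (- 2 / of_int (- int k)) (heis_lat (- \<alpha>) (- int k) w) else 0) =
    os_dilate (- 1) (\<lambda>k w. if odd k then mscale (- 2 / of_int (- int k)) (heis_lat \<alpha> (- int k) w) else 0)"
    by (intro ext) (auto simp: os_dilate_def heis_lat_minus mscale_minus[symmetric] mscale_def[symmetric] intro!: mscale_eqI)
  moreover have "fock_linear (\<lambda>w. if odd k then mscale (- 2 / of_int (- int k)) (heis_lat \<alpha> (- int k) w) else 0)" for k
    by (cases "odd k") (simp_all add: fock_linear_const0 fock_linear_compose[OF fock_linear_mscale fock_linear_heis_lat])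
  ultimately have "Eminus (- \<alpha>) = os_dilate (- 1) (Eminus \<alpha>)"
    unfolding Eminus_def by (simp add: os_exp_dilate del: of_int_minus of_int_of_nat_eq)
  thus ?thesis by (simp add: os_dilate_def)
qed

lemma Eplus_minus: "Eplus (- \<alpha>) k w = mscale ((- 1) ^ k) (Eplus \<alpha> k w)"
proof -
  have "(\<lambda>k w. if odd k then mscale (- 2 / of_int (int k)) (heis_lat (- \<alpha>) (int k) w) else 0) =
    os_dilate (- 1) (\<lambda>k w. if odd k then mscale (- 2 / of_int (int k)) (heis_lat \<alpha> (int k) w) else 0)"
    by (intro ext) (auto simp: os_dilate_def heis_lat_minus mscale_minus[symmetric] mscale_def[symmetric] intro!: mscale_eqI)
  moreover have "fock_linear (\<lambda>w. if odd k then mscale (- 2 / of_int (int k)) (heis_lat \<alpha> (int k) w) else 0)" for k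
    by (cases "odd k") (simp_all add: fock_linear_const0 fock_linear_compose[OF fock_linear_mscale fock_linear_heis_lat])
  ultimately have "Eplus (- \<alpha>) = os_dilate (- 1) (Eplus \<alpha>)"
    unfolding Eplus_def by (simp add: os_exp_dilate del: of_int_minus of_int_of_nat_eq)
  thus ?thesis by (simp add: os_dilate_def)
qed

lemma Eminus2_swap:
  assumes "a \<noteq> 0"
  shows "Eminus2 j i (inverse a) p w = mscale (inverse (- a) ^ p) (Eminus2 i j a p w)"
proof -
  have "Eminus2 i j a p w =
      (\<Sum>l\<le>p. mscale (a ^ (p - l) * (- 1) ^ (p - l)) (Eminus (eps i) l (Eminus (eps j) (p - l) w)))"
    by (simp add: Eminus2_def os_mult_def os_dilate_def Eminus_minus fock_linear_scale[OF fock_linear_Eminus])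
  also have "\<dots> = (\<Sum>l\<le>p. mscale (a ^ l * (- 1) ^ l) (Eminus (eps i) (p - l) (Eminus (eps j) l w)))"
    by (rule sum.reindex_bij_witness[of _ "\<lambda>l. p - l" "\<lambda>l. p - l"]) auto
  finally have 1: "Eminus2 i j a p w = (\<Sum>l\<le>p. mscale ((- a) ^ l) (Eminus (eps i) (p - l) (Eminus (eps j) l w)))"
    by (simp add: power_mult_distrib[symmetric])
  have "Eminus2 j i (inverse a) p w =
      (\<Sum>l\<le>p. mscale (inverse (- a) ^ (p - l)) (Eminus (eps i) (p - l) (Eminus (eps j) l w)))"
    unfolding Eminus2_def os_mult_def os_dilate_def Eminus_minus fock_linear_scale[OF fock_linear_Eminus] mscale_mscale
    by (simp add: power_mult_distrib[symmetric] Eminus_commute[of "eps j"])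
  moreover have "inverse (- a) ^ (p - l) = inverse (- a) ^ p * (- a) ^ l" if "l \<le> p" for l
  proof -
    have "inverse (- a) ^ p = inverse (- a) ^ (p - l) * inverse (- a) ^ l"
      using that by (simp add: power_add[symmetric])
    thus ?thesis using assms by (simp add: power_mult_distrib[symmetric] mult.assoc)
  qed
  ultimately show ?thesis unfolding 1 mscale_sum mscale_mscale by (auto intro!: sum.cong)
qed

lemma Eplus2_swap:
  assumes "a \<noteq> 0"
  shows "Eplus2 j i (inverse a) p w = mscale ((- a) ^ p) (Eplus2 i j a p w)"
proof -
  have "Eplus2 i j a p w =
      (\<Sum>l\<le>p. mscale (inverse a ^ (p - l) * (- 1) ^ (p - l)) (Eplus (eps i) l (Eplus (eps j) (p - l) w)))"
    by (simp add: Eplus2_def os_mult_def os_dilate_def Eplus_minus fock_linear_scale[OF fock_linear_Eplus])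
  also have "\<dots> = (\<Sum>l\<le>p. mscale (inverse a ^ l * (- 1) ^ l) (Eplus (eps i) (p - l) (Eplus (eps j) l w)))"
    by (rule sum.reindex_bij_witness[of _ "\<lambda>l. p - l" "\<lambda>l. p - l"]) auto
  finally have 1: "Eplus2 i j a p w = (\<Sum>l\<le>p. mscale (inverse (- a) ^ l) (Eplus (eps i) (p - l) (Eplus (eps j) l w)))"
    by (simp add: power_mult_distrib[symmetric])
  have "Eplus2 j i (inverse a) p w =
      (\<Sum>l\<le>p. mscale ((- a) ^ (p - l)) (Eplus (eps i) (p - l) (Eplus (eps j) l w)))"
    unfolding Eplus2_def os_mult_def os_dilate_def Eplus_minus fock_linear_scale[OF fock_linear_Eplus] mscale_mscale
    by (simp add: power_mult_distrib[symmetric] Eplus_commute[of "eps j"])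
  moreover have "(- a) ^ (p - l) = (- a) ^ p * inverse (- a) ^ l" if "l \<le> p" for l
  proof -
    have "(- a) ^ p = (- a) ^ (p - l) * (- a) ^ l"
      using that by (simp add: power_add[symmetric])
    thus ?thesis using assms by (simp add: power_mult_distrib[symmetric] mult.assoc)
  qed
  ultimately show ?thesis unfolding 1 mscale_sum mscale_mscale by (auto intro!: sum.cong)
qed

lemma vertex_swap:
  assumes "a \<noteq> 0"
  shows "vertex j i (inverse a) n w = mscale ((- a) powi n) (vertex i j a n w)"
proof -
  let ?f = "\<lambda>(p, q). if int q - int p = n then Eminus2 i j a p (Eplus2 i j a q w) else 0"
  let ?g = "\<lambda>(p, q). if int q - int p = n then Eminus2 j i (inverse a) p (Eplus2 j i (inverse a) q w) else 0"
  have na: "- a \<noteq> 0" using assms by simp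
  have c: "(- a) powi (int q - int p) = (- a) ^ q * inverse (- a) ^ p" for p q
    using na by (simp add: power_int_diff power_inverse divide_inverse flip: inverse_minus_eq)
  have g: "?g x = mscale ((- a) powi n) (?f x)" for x
    by (cases x) (auto simp: Eminus2_swap[OF assms] Eplus2_swap[OF assms] fock_linear_scale[OF fock_linear_Eminus2] c)
  define S where "S = {x. ?f x \<noteq> 0}"
  have S: "finite S"
    unfolding S_def using vertex_summands_finite[of n i j a w] by (simp add: case_prod_unfold)
  have "Sum_any ?f = sum ?f S" unfolding S_def by (simp add: Sum_any.expand_set)
  moreover have "Sum_any ?g = sum ?g S"
    using g by (intro Sum_any.expand_superset S) (auto simp: S_def)
  ultimately show ?thesis unfolding vertex_def by (simp add: g mscale_sum)
qed

lemma grp_op_scale: "grp_op \<alpha> (mscale c w) = mscale c (grp_op \<alpha> w)"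
proof (cases "c = 0")
  case False
  hence "Poly_Mapping.keys (mscale c w) = Poly_Mapping.keys w"
    by (auto simp: in_keys_iff poly_mapping_eq_iff fun_eq_iff)
  moreover have "mscale c (Poly_Mapping.single k s) = Poly_Mapping.single k (cscale c s)" for k :: "'a lattice2" and s
    by (rule poly_mapping_eqI) (simp add: lookup_single when_def)
  ultimately show ?thesis by (simp add: grp_op_def mscale_sum cscale_cscale mult.commute)
qed (simp add: grp_op_def)

lemma grp_op_minus: "grp_op (- \<alpha>) w = grp_op \<alpha> w"
proof -
  have "red2 (- \<alpha>) = red2 \<alpha>" by (auto simp: red2_def vec_eq_iff)
  moreover have "cocyc (- \<alpha>) \<beta> = cocyc \<alpha> \<beta>" for \<beta>
  proof -
    have "(if i \<le> j then 1 else - 1 :: complex) powi (- (k * l)) = (if i \<le> j then 1 else - 1) powi (k * l)"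
      for i j :: 'a and k l by (cases "even (k * l)") auto
    thus ?thesis by (simp add: cocyc_def)
  qed
  ultimately show ?thesis by (simp add: grp_op_def)
qed

definition y_op :: "'n::{finite,linorder} \<Rightarrow> 'n \<Rightarrow> complex \<Rightarrow> int \<Rightarrow> 'n fock \<Rightarrow> 'n fock" where
  "y_op i j a m w = x_op i j a m w + mscale (if m = 0 \<and> i = j \<and> a \<noteq> 1 then (1 + a) / (1 - a) else 0) w"

lemma y_op_swap:
  assumes "a \<noteq> 0"
  shows "y_op j i (inverse a) m w = - mscale ((- a) powi m) (y_op i j a m w)"
proof (cases "i = j")
  case False
  have c: "cocyc (eps j) (eps i) = - cocyc (eps i) (eps j)"
    using False by (auto simp: cocyc_eps)
  have "grp_op (eps j - eps i) v = grp_op (eps i - eps j) v" for v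
    using grp_op_minus[of "eps i - eps j"] by simp
  thus ?thesis using False
    by (simp add: y_op_def x_op_def vertex_swap[OF assms] grp_op_scale c mscale_minus mult.commute)
next
  case True
  show ?thesis
  proof (cases "a = 1")
    case a: True
    have "heis j m w = - mscale ((- 1) powi m) (heis j m w)"
      by (cases "even m") (simp_all add: heis_def[of _ m] mscale_minus)
    thus ?thesis using True a by (simp add: y_op_def x_op_def mscale_minus) (metis mscale_minus mscale_mscale mult.commute minus_mult_right)
  next
    case a: False
    have k: "(1 + inverse a) / (1 - inverse a) = - ((1 + a) / (1 - a))"
      using a assms by (simp add: field_simps)
    have "inverse a \<noteq> 1" using a by (metis inverse_1 inverse_inverse_eq)
    hence "y_op j j (inverse a) m w = mscale ((1 + inverse a) / (1 - inverse a)) (vertex j j (inverse a) m w)"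
      by (auto simp: y_op_def x_op_def mscale_diff)
    moreover have "y_op j j a m w = mscale ((1 + a) / (1 - a)) (vertex j j a m w)"
      using a by (auto simp: y_op_def x_op_def mscale_diff)
    ultimately show ?thesis
      unfolding k using True by (simp add: vertex_swap[OF assms] mscale_minus mult.commute)
  qed
qed


lemma fock_linear_vertex: "fock_linear (vertex i j a n)"
proof (rule fock_linearI)
  define f where "f x w = (case x of (p, q) \<Rightarrow> if int q - int p = n then Eminus2 i j a p (Eplus2 i j a q w) else 0)" for x w
  have v: "vertex i j a n w = Sum_any (\<lambda>x. f x w)" for w
    unfolding vertex_def f_def ..
  have fin: "finite {x. f x w \<noteq> 0}" for w
    using vertex_summands_finite[of n i j a w] unfolding f_def by (simp add: case_prod_unfold)
  have lin: "fock_linear (f x)" for x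
    unfolding fock_linear_def f_def
    by (cases x) (simp add: fock_linear_add[OF fock_linear_Eminus2] fock_linear_add[OF fock_linear_Eplus2]
        fock_linear_scale[OF fock_linear_Eminus2] fock_linear_scale[OF fock_linear_Eplus2])
  show "vertex i j a n (u + w) = vertex i j a n u + vertex i j a n w" for u w
    unfolding v fock_linear_add[OF lin] by (rule Sum_any.distrib[OF fin fin])
  show "vertex i j a n (mscale c w) = mscale c (vertex i j a n w)" for c w
  proof -
    have "Sum_any (\<lambda>x. f x (mscale c w)) = sum (\<lambda>x. f x (mscale c w)) {x. f x w \<noteq> 0}"
      by (rule Sum_any.expand_superset[OF fin]) (auto simp: fock_linear_scale[OF lin])
    thus ?thesis unfolding v by (simp add: fock_linear_scale[OF lin] Sum_any.expand_set mscale_sum)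
  qed
qed

lemma grp_op_add: "grp_op \<alpha> (v + w) = grp_op \<alpha> v + grp_op \<alpha> w"
  unfolding grp_op_def
  using lext_add[where f = "\<lambda>g s. Poly_Mapping.single (red2 \<alpha> + g) (cscale (cocyc \<alpha> (rep2 g)) s)"]
  by (simp add: single_add[symmetric] cscale_add)

lemma fock_linear_grp_op: "fock_linear (grp_op \<alpha>)"
  by (rule fock_linearI) (simp_all add: grp_op_add grp_op_scale)

lemma fock_linear_y_op: "fock_linear (y_op i j a m)"
proof -
  have "fock_linear (\<lambda>w. vertex i i a m w - (if m = 0 then w else 0))"
    by (rule fock_linearI)
      (simp_all add: fock_linear_add[OF fock_linear_vertex] fock_linear_scale[OF fock_linear_vertex] mscale_diff)
  hence 2: "fock_linear (\<lambda>w. mscale c (vertex i i a m w - (if m = 0 then w else 0)))" for c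
    by (rule fock_linear_compose[OF fock_linear_mscale])
  have 1: "fock_linear (\<lambda>w. mscale c (grp_op \<alpha> (vertex i j a m w)))" for c \<alpha>
    by (rule fock_linear_compose[OF fock_linear_mscale fock_linear_compose[OF fock_linear_grp_op fock_linear_vertex]])
  have "fock_linear (x_op i j a m)"
    using 1 2 fock_linear_compose[OF fock_linear_mscale fock_linear_heis]
    unfolding x_op_def by (cases "i = j"; cases "a = 1") simp_all
  thus ?thesis unfolding y_op_def
    by (intro fock_linearI)
      (simp_all add: fock_linear_add fock_linear_scale mscale_add mult.commute)
qed

definition fock_rho :: "('g::ab_group_add \<Rightarrow> complex) \<Rightarrow> ('n::{finite,linorder}, 'g) ghat \<Rightarrow> 'n fock \<Rightarrow> 'n fock" where
  "fock_rho \<sigma> x w =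
     (\<Sum>i\<in>UNIV. \<Sum>j\<in>UNIV. \<Sum>k\<in>Poly_Mapping.keys (fst x $ i $ j).
        mscale (Poly_Mapping.lookup (fst x $ i $ j) k / 4) (y_op i j (\<sigma> (snd k)) (fst k) w))
     + mscale (snd x / 2) w"

lemma fock_linear_fock_rho: "fock_linear (fock_rho \<sigma> x)"
proof -
  have "fock_linear (\<lambda>w. \<Sum>i\<in>UNIV. \<Sum>j\<in>UNIV. \<Sum>k\<in>Poly_Mapping.keys (fst x $ i $ j).
        mscale (Poly_Mapping.lookup (fst x $ i $ j) k / 4) (y_op i j (\<sigma> (snd k)) (fst k) w))"
    by (intro fock_linear_sum_fun fock_linear_compose[OF fock_linear_mscale fock_linear_y_op])
  thus ?thesis
    unfolding fock_linear_def fock_rho_def by (simp add: mscale_add mult.commute add_ac)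
qed

lemma fock_rho_add: "fock_rho \<sigma> (x + y) w = fock_rho \<sigma> x w + fock_rho \<sigma> y w"
proof -
  have "(\<Sum>k\<in>Poly_Mapping.keys (p + q). mscale (Poly_Mapping.lookup (p + q) k / 4) (y_op i j (\<sigma> (snd k)) (fst k) w)) =
    (\<Sum>k\<in>Poly_Mapping.keys p. mscale (Poly_Mapping.lookup p k / 4) (y_op i j (\<sigma> (snd k)) (fst k) w)) +
    (\<Sum>k\<in>Poly_Mapping.keys q. mscale (Poly_Mapping.lookup q k / 4) (y_op i j (\<sigma> (snd k)) (fst k) w))" for i j p q
    by (rule lext_add[where f = "\<lambda>k a. mscale (a / 4) (y_op i j (\<sigma> (snd k)) (fst k) w)"])
      (simp_all add: mscale_add_left add_divide_distrib)
  thus ?thesis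
    by (simp add: fock_rho_def sum.distrib mscale_add_left add_divide_distrib)
qed

lemma fock_rho_scale:
  fixes x :: "('n::{finite,linorder}, 'g::ab_group_add) ghat"
  shows "fock_rho \<sigma> (hat_scale c x) w = mscale c (fock_rho \<sigma> x w)"
proof (cases "c = 0")
  case True thus ?thesis by (auto simp: fock_rho_def hat_scale_def intro!: sum.neutral)
next
  case False
  hence "Poly_Mapping.keys (cscale c p) = Poly_Mapping.keys p" for p :: "'g rsig"
    by (auto simp: in_keys_iff)
  thus ?thesis by (simp add: fock_rho_def hat_scale_def mscale_sum mscale_add)
qed

lemma fock_rho_mat_unit:
  "fock_rho \<sigma> (mat_unit i j (Poly_Mapping.single (m, \<alpha>) c), 0) w = mscale (c / 4) (y_op i j (\<sigma> \<alpha>) m w)"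
proof -
  have "fock_rho \<sigma> (mat_unit i j (Poly_Mapping.single (m, \<alpha>) c), 0) w =
     (\<Sum>x\<in>UNIV. \<Sum>y\<in>UNIV. if y = j then (if x = i then mscale (c / 4) (y_op i j (\<sigma> \<alpha>) m w) else 0) else 0)"
    unfolding fock_rho_def fst_conv snd_conv
    by (simp only: div_0 mscale_zero_left add_0_right, intro sum.cong refl) (auto simp: mat_unit_def)
  also have "\<dots> = (\<Sum>x\<in>UNIV. if x = i then mscale (c / 4) (y_op i j (\<sigma> \<alpha>) m w) else 0)"
    by (intro sum.cong refl) (auto simp: sum.delta)
  finally show ?thesis by (simp add: sum.delta)
qed

lemma fock_action_exists:
  assumes "character \<sigma>"
  shows "fock_action \<sigma> (fock_rho \<sigma>)"
  unfolding fock_action_def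
proof (intro conjI allI ballI)
  fix i j :: "'n::{finite,linorder}" and m \<alpha> and w :: "'n fock"
  have nz: "\<sigma> \<alpha> \<noteq> 0" by (rule character_nz[OF assms])
  let ?b = "(- 1) powi m * \<sigma> (- \<alpha>) powi m"
  have "e_gen \<sigma> i j m \<alpha> = (mat_unit i j (Poly_Mapping.single (m, \<alpha>) 1), 0)
      + (mat_unit j i (Poly_Mapping.single (m, - \<alpha>) (- ?b)), 0)"
    unfolding e_gen_def rbar_single
    by (auto simp: mat_unit_def vec_eq_iff single_uminus)
  hence "fock_rho \<sigma> (e_gen \<sigma> i j m \<alpha>) w = mscale (1/4) (y_op i j (\<sigma> \<alpha>) m w)
      + mscale (- ?b / 4) (y_op j i (inverse (\<sigma> \<alpha>)) m w)"
    by (simp only: fock_rho_add fock_rho_mat_unit character_minus[OF assms])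
  also have "\<dots> = mscale (1/4) (y_op i j (\<sigma> \<alpha>) m w) + mscale (?b * (- \<sigma> \<alpha>) powi m / 4) (y_op i j (\<sigma> \<alpha>) m w)"
    by (simp add: y_op_swap[OF nz] mscale_minus[symmetric])
  also have "?b * (- \<sigma> \<alpha>) powi m = 1"
    using nz by (simp add: character_minus[OF assms] power_int_mult_distrib[symmetric])
  finally have "fock_rho \<sigma> (e_gen \<sigma> i j m \<alpha>) w = mscale (1/2) (y_op i j (\<sigma> \<alpha>) m w)"
    by (simp add: mscale_add_left[symmetric])
  thus "fock_rho \<sigma> (hat_scale 2 (e_gen \<sigma> i j m \<alpha>)) w = x_op i j (\<sigma> \<alpha>) m w
      + mscale (if m = 0 \<and> i = j \<and> \<sigma> \<alpha> \<noteq> 1 then (1 + \<sigma> \<alpha>) / (1 - \<sigma> \<alpha>) else 0) w"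
    by (simp add: fock_rho_scale y_op_def)
next
  fix w show "fock_rho \<sigma> hat_c w = mscale (1 / 2) w"
    by (simp add: fock_rho_def hat_c_def)
qed (simp_all add: fock_rho_add fock_rho_scale fock_linear_add[OF fock_linear_fock_rho]
      fock_linear_scale[OF fock_linear_fock_rho])

end

theory Submission
  imports Defs
begin

text \<open>
  The form is the one for which the monomials \<open>e\<^sup>g \<otimes> \<mu>\<close> are orthogonal, of norm independent of \<open>g\<close>,
  and \<open>\<epsilon>\<^sub>i(n)\<close> is adjoint to \<open>\<epsilon>\<^sub>i(-n)\<close> (\<open>adjoint_heis\<close>). Everything else follows
  from these properties. The exponent of
  \<open>E\<^sub>\<plusminus>(\<alpha>,z)\<close> carries the factor \<open>1/n\<close>, so passing to the adjoint turns \<open>E\<^sub>-(\<alpha>)\<close> into \<open>E\<^sub>+(-\<alpha>)\<close>, which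
  differs from \<open>E\<^sub>+(\<alpha>)\<close> by \<open>(-1)\<^sup>k\<close> in degree \<open>k\<close>. When \<open>|a| = 1\<close>, conjugating the powers of \<open>a\<close> amounts
  to inverting them, and inverse powers of \<open>a\<close> are exactly what \<open>E\<^sub>+(-\<epsilon>\<^sub>j,az)\<close> has where \<open>E\<^sub>-(-\<epsilon>\<^sub>j,az)\<close>
  has powers. Hence the adjoint of the \<open>n\<close>-th mode of the vertex operator is \<open>(-1)\<^sup>n\<close> times its
  \<open>-n\<close>-th mode (\<open>adjoint_vertex\<close>). The remaining factors, the group element \<open>e\<^sup>\<alpha>\<close> for
  \<open>\<alpha> = \<epsilon>\<^sub>i - \<epsilon>\<^sub>j\<close> and the scalar \<open>(1 + a)/(1 - a)\<close>, are skew-adjoint, which gives the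
  sign \<open>(-1)\<^sup>m\<^sup>+\<^sup>1\<close> in \<open>\<tau>\<close> (\<open>adjoint_y_op\<close>).
  If \<open>\<sigma>(\<alpha>) \<noteq> 1\<close>, the additive constant in the action of \<open>e\<^sub>i\<^sub>i(0,\<alpha>)\<close> cancels the \<open>-1\<close> in \<open>X\<^sub>i\<^sub>i(a,z)\<close>: what acts
  is a multiple of the vertex operator alone.

  The algebra side rests on the fact that \<open>t\<^sup>m e\<^sup>\<alpha> \<mapsto> (t\<^sup>m e\<^sup>\<alpha>)\<^sup>-\<^sup>1\<close> extends to a conjugate-linear
  anti-involution of \<open>R\<^sub>\<sigma>\<close> when \<open>\<sigma>\<close> is unitary; combined with the transposition of matrices it is
  \<open>tau_dag \<sigma>\<close>. The elements \<open>e\<^sub>i\<^sub>j(m,\<alpha>)\<close> and \<open>c\<close> span the unitary Lie algebra (\<open>u_hat_induct\<close>), so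
  that \<open>\<tau>\<close> is \<open>tau_dag \<sigma>\<close> there and the adjoint relation has to be checked on these elements only.
\<close>

section \<open>The Hermitian form\<close>

text \<open>
  The value of the form on a monomial paired with itself. The factors are forced: \<open>\<epsilon>\<^sub>i(n)\<close> and
  \<open>\<epsilon>\<^sub>i(-n)\<close> are to be adjoint and \<open>[\<epsilon>\<^sub>i(n), \<epsilon>\<^sub>i(-n)] = n/2\<close>, so one more factor \<open>(i, k)\<close> in \<open>\<mu>\<close>, where
  \<open>n = 2k + 1\<close>, multiplies the value by \<open>n/2\<close> times the new exponent.
\<close>

definition mono_norm :: "('n \<times> nat \<Rightarrow>\<^sub>0 nat) \<Rightarrow> real" where
  "mono_norm \<mu> = (\<Prod>v\<in>Poly_Mapping.keys \<mu>. fact (Poly_Mapping.lookup \<mu> v) * ((2 * real (snd v) + 1) / 2) ^ Poly_Mapping.lookup \<mu> v)"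

definition sym_form :: "'n sym \<Rightarrow> 'n sym \<Rightarrow> complex" where
  "sym_form p q = (\<Sum>\<mu>\<in>Poly_Mapping.keys p. Poly_Mapping.lookup p \<mu> * cnj (Poly_Mapping.lookup q \<mu>) * of_real (mono_norm \<mu>))"

definition fock_form :: "'n::finite fock \<Rightarrow> 'n fock \<Rightarrow> complex" where
  "fock_form v w = (\<Sum>g\<in>Poly_Mapping.keys v. sym_form (Poly_Mapping.lookup v g) (Poly_Mapping.lookup w g))"

lemma mono_norm_pos: "mono_norm \<mu> > 0"
  unfolding mono_norm_def by (intro prod_pos) auto

lemma mono_norm_superset:
  assumes "finite A" "Poly_Mapping.keys \<mu> \<subseteq> A"
  shows "mono_norm \<mu> = (\<Prod>v\<in>A. fact (Poly_Mapping.lookup \<mu> v) * ((2 * real (snd v) + 1) / 2) ^ Poly_Mapping.lookup \<mu> v)"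
  unfolding mono_norm_def
  using assms by (intro prod.mono_neutral_left) (auto simp: in_keys_iff)

lemma mono_norm_add_var:
  "mono_norm (Poly_Mapping.single v 1 + \<mu>) = (real (Poly_Mapping.lookup \<mu> v) + 1) * ((2 * real (snd v) + 1) / 2) * mono_norm \<mu>"
proof -
  define A where "A = insert v (Poly_Mapping.keys \<mu>)"
  define f where "f e u = fact e * ((2 * real (snd u) + 1) / 2) ^ e" for e :: nat and u :: "'a \<times> nat"
  have A: "finite A" "v \<in> A" "Poly_Mapping.keys \<mu> \<subseteq> A" "Poly_Mapping.keys (Poly_Mapping.single v 1 + \<mu>) \<subseteq> A"
    using keys_add[of "Poly_Mapping.single v (1::nat)" \<mu>] by (auto simp: A_def)
  have "mono_norm (Poly_Mapping.single v 1 + \<mu>) = (\<Prod>u\<in>A. f (Poly_Mapping.lookup (Poly_Mapping.single v 1 + \<mu>) u) u)"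
    unfolding f_def by (rule mono_norm_superset[OF A(1,4)])
  also have "\<dots> = f (Poly_Mapping.lookup \<mu> v + 1) v * (\<Prod>u\<in>A - {v}. f (Poly_Mapping.lookup \<mu> u) u)"
    unfolding prod.remove[OF A(1,2)]
    by (intro arg_cong2[where f = "(*)"] prod.cong) (auto simp: lookup_add lookup_single when_def)
  also have "f (Poly_Mapping.lookup \<mu> v + 1) v = (real (Poly_Mapping.lookup \<mu> v) + 1) * ((2 * real (snd v) + 1) / 2) * f (Poly_Mapping.lookup \<mu> v) v"
    by (simp add: f_def field_simps)
  finally show ?thesis
    unfolding mono_norm_superset[OF A(1,3)] f_def[symmetric] prod.remove[OF A(1,2)] by (simp add: mult.assoc)
qed

lemma sym_form_add_left: "sym_form (p + q) r = sym_form p r + sym_form q r"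
  unfolding sym_form_def
  by (rule lext_add[where f = "\<lambda>\<mu> a. a * cnj (Poly_Mapping.lookup r \<mu>) * of_real (mono_norm \<mu>)"])
    (simp_all add: algebra_simps)

lemma sym_form_zero [simp]: "sym_form 0 q = 0" "sym_form p 0 = 0"
  by (simp_all add: sym_form_def)

lemma sym_form_single: "sym_form (Poly_Mapping.single \<mu> c) q = c * cnj (Poly_Mapping.lookup q \<mu>) * of_real (mono_norm \<mu>)"
  by (cases "c = 0") (simp_all add: sym_form_def)

lemma sym_form_cscale_left: "sym_form (cscale c p) q = c * sym_form p q"
  by (induction p rule: pm_induct) (simp_all add: sym_form_single sym_form_add_left cscale_add algebra_simps)

lemma sym_form_cnj: "sym_form q p = cnj (sym_form p q)"
proof -
  have sup: "sym_form p q = (\<Sum>\<mu>\<in>Poly_Mapping.keys p \<union> Poly_Mapping.keys q. Poly_Mapping.lookup p \<mu> * cnj (Poly_Mapping.lookup q \<mu>) * of_real (mono_norm \<mu>))"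
    for p q :: "'a sym"
    unfolding sym_form_def by (intro sum.mono_neutral_left) (auto simp: in_keys_iff)
  show ?thesis
    unfolding sup by (simp add: Un_commute[of "Poly_Mapping.keys q"] mult.commute[of "Poly_Mapping.lookup q _"])
qed

lemma sym_form_cscale_right: "sym_form p (cscale c q) = cnj c * sym_form p q"
  by (simp add: sym_form_cnj[of p] sym_form_cscale_left)

lemma sym_form_pos: "p \<noteq> 0 \<Longrightarrow> Re (sym_form p p) > 0"
  unfolding sym_form_def Re_sum
  by (rule sum_pos)
    (auto simp: in_keys_iff mono_norm_pos mult_pos_pos complex_norm_square[symmetric]
      simp flip: of_real_mult of_real_power)

text \<open>On monomials this is the recursion \<open>mono_norm_add_var\<close>; it is the statement that \<open>\<epsilon>\<^sub>i(-n)\<close> and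
  \<open>\<epsilon>\<^sub>i(n)\<close> are adjoint, for one copy of the symmetric algebra.\<close>

lemma sym_form_var:
  "sym_form (sym_var v * p) q = sym_form p (cscale ((2 * of_nat (snd v) + 1) / 2) (sym_deriv v q))"
proof (induction p rule: pm_induct)
  case (single \<mu> c)
  have "of_real (mono_norm (Poly_Mapping.single v 1 + \<mu>)) =
      (of_nat (Poly_Mapping.lookup \<mu> v) + 1) * ((2 * of_nat (snd v) + 1) / 2) * (of_real (mono_norm \<mu>) :: complex)"
    unfolding mono_norm_add_var by simp
  thus ?case
    by (simp add: sym_var_def mult_single sym_form_single lookup_sym_deriv add.commute[of \<mu>])
qed (simp add: sym_form_add_left distrib_left)

lemma fock_form_add_left: "fock_form (u + v) w = fock_form u w + fock_form v w"
  unfolding fock_form_def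
  by (rule lext_add[where f = "\<lambda>g s. sym_form s (Poly_Mapping.lookup w g)"]) (simp_all add: sym_form_add_left)

lemma fock_form_zero [simp]: "fock_form 0 w = 0" "fock_form w 0 = 0"
  by (simp_all add: fock_form_def)

lemma fock_form_single: "fock_form (Poly_Mapping.single g s) w = sym_form s (Poly_Mapping.lookup w g)"
  by (cases "s = 0") (simp_all add: fock_form_def)

lemma mscale_single: "mscale c (Poly_Mapping.single g s) = Poly_Mapping.single g (cscale c s)"
  by (rule poly_mapping_eqI) (simp add: lookup_single when_def)

lemma fock_form_scale_left: "fock_form (mscale c v) w = c * fock_form v w"
  by (induction v rule: pm_induct)
    (simp_all add: fock_form_single mscale_single sym_form_cscale_left fock_form_add_left mscale_add algebra_simps)

lemma fock_form_cnj: "fock_form w v = cnj (fock_form v w)"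
proof -
  have sup: "fock_form v w = (\<Sum>g\<in>Poly_Mapping.keys v \<union> Poly_Mapping.keys w. sym_form (Poly_Mapping.lookup v g) (Poly_Mapping.lookup w g))" for v w :: "'a fock"
    unfolding fock_form_def by (intro sum.mono_neutral_left) (auto simp: in_keys_iff)
  show ?thesis
    unfolding sup by (simp add: Un_commute[of "Poly_Mapping.keys w"] sym_form_cnj[of "Poly_Mapping.lookup w _"])
qed

lemma fock_form_add_right: "fock_form w (u + v) = fock_form w u + fock_form w v"
  by (simp add: fock_form_cnj[of w] fock_form_add_left)

lemma fock_form_scale_right: "fock_form w (mscale c v) = cnj c * fock_form w v"
  by (simp add: fock_form_cnj[of w] fock_form_scale_left)

lemma fock_form_sum_left: "fock_form (sum f A) w = (\<Sum>x\<in>A. fock_form (f x) w)"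
  by (induction A rule: infinite_finite_induct) (simp_all add: fock_form_add_left)

lemma fock_form_sum_right: "fock_form w (sum f A) = (\<Sum>x\<in>A. fock_form w (f x))"
  by (induction A rule: infinite_finite_induct) (simp_all add: fock_form_add_right)

lemma pos_def_hermitian_fock_form: "pos_def_hermitian fock_form"
  unfolding pos_def_hermitian_def
proof (intro conjI allI impI)
  fix v :: "'a fock" assume "v \<noteq> 0"
  thus "Re (fock_form v v) > 0"
    unfolding fock_form_def Re_sum by (intro sum_pos) (auto simp: in_keys_iff sym_form_pos)
qed (rule fock_form_add_left fock_form_scale_left fock_form_cnj)+


section \<open>Adjoints of the vertex operators\<close>

definition adjoint_pair :: "('n::finite fock \<Rightarrow> 'n fock) \<Rightarrow> ('n fock \<Rightarrow> 'n fock) \<Rightarrow> bool" where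
  "adjoint_pair A B \<longleftrightarrow> (\<forall>v w. fock_form (A v) w = fock_form v (B w))"

lemma adjoint_pair_sym: "adjoint_pair A B \<Longrightarrow> adjoint_pair B A"
  unfolding adjoint_pair_def by (metis fock_form_cnj)

lemma adjoint_pair_zero: "adjoint_pair (\<lambda>w. 0) (\<lambda>w. 0)"
  by (simp add: adjoint_pair_def)

lemma adjoint_pair_mscale: "adjoint_pair (mscale c) (mscale (cnj c))"
  by (simp add: adjoint_pair_def fock_form_scale_left fock_form_scale_right)

lemma adjoint_pair_compose:
  "adjoint_pair A A' \<Longrightarrow> adjoint_pair B B' \<Longrightarrow> adjoint_pair (\<lambda>w. A (B w)) (\<lambda>w. B' (A' w))"
  by (simp add: adjoint_pair_def)

lemma adjoint_pair_scale:
  "adjoint_pair A B \<Longrightarrow> adjoint_pair (\<lambda>w. mscale c (A w)) (\<lambda>w. mscale (cnj c) (B w))"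
  by (simp add: adjoint_pair_def fock_form_scale_left fock_form_scale_right)

lemma adjoint_pair_sum:
  "(\<And>x. x \<in> S \<Longrightarrow> adjoint_pair (f x) (g x)) \<Longrightarrow> adjoint_pair (\<lambda>w. \<Sum>x\<in>S. f x w) (\<lambda>w. \<Sum>x\<in>S. g x w)"
  by (simp add: adjoint_pair_def fock_form_sum_left fock_form_sum_right)

lemma adjoint_heis: "adjoint_pair (heis i n) (heis i (- n))"
proof -
  have neg: "adjoint_pair (heis i n) (heis i (- n))" if "n < 0" for n
  proof (cases "even n")
    case True
    thus ?thesis by (simp add: adjoint_pair_def heis_def)
  next
    case False
    have "fock_form (heis i n v) w = fock_form v (heis i (- n) w)" for v w
    proof (induction v rule: pm_induct)
      case (single g s)
      define k where "k = nat ((- n - 1) div 2)"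
      have n: "- n = 2 * int k + 1" using that False by (auto simp: k_def elim!: oddE)
      have "heis i n (Poly_Mapping.single g s) = Poly_Mapping.single g (sym_var (i, k) * s)"
        using that False by (intro poly_mapping_eqI) (simp add: lookup_heis lookup_single when_def k_def)
      moreover have "Poly_Mapping.lookup (heis i (- n) w) g = cscale ((2 * of_nat k + 1) / 2) (sym_deriv (i, k) (Poly_Mapping.lookup w g))"
        unfolding n by (simp add: lookup_heis)
      ultimately show ?case by (simp add: fock_form_single sym_form_var)
    qed (simp add: fock_linear_add[OF fock_linear_heis] fock_form_add_left)
    thus ?thesis by (simp add: adjoint_pair_def)
  qed
  consider "n < 0" | "n = 0" | "n > 0" by linarith
  thus ?thesis
  proof cases
    case 2 thus ?thesis by (simp add: adjoint_pair_def heis_def)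
  next
    case 3 thus ?thesis using adjoint_pair_sym[OF neg[of "- n"]] by simp
  qed (rule neg)
qed

lemma adjoint_heis_lat: "adjoint_pair (heis_lat \<alpha> n) (heis_lat \<alpha> (- n))"
proof -
  have "adjoint_pair (\<lambda>w. \<Sum>i\<in>UNIV. mscale (of_int (\<alpha> $ i)) (heis i n w))
     (\<lambda>w. \<Sum>i\<in>UNIV. mscale (cnj (of_int (\<alpha> $ i))) (heis i (- n) w))"
    by (intro adjoint_pair_sum adjoint_pair_scale adjoint_heis)
  thus ?thesis by (simp add: heis_lat_def[abs_def])
qed

text \<open>
  Taking adjoints reverses the order of the factors in a power of \<open>A\<close>; that the coefficients of
  \<open>B\<close> commute with each other restores it.
\<close>

lemma adjoint_os_exp:
  assumes lin: "\<And>k. fock_linear (B k)"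
    and com: "\<And>k. commutes (B k) B"
    and adj: "\<And>k. adjoint_pair (A k) (B k)"
  shows "adjoint_pair (os_exp A k) (os_exp B k)"
proof -
  have pow: "adjoint_pair (os_pow A r k) (os_pow B r k)" for r k
  proof (induction r arbitrary: k)
    case 0
    show ?case by (simp add: adjoint_pair_def os_one_def)
  next
    case (Suc r)
    have "adjoint_pair (\<lambda>w. \<Sum>l\<le>k. A l (os_pow A r (k - l) w)) (\<lambda>w. \<Sum>l\<le>k. os_pow B r (k - l) (B l w))"
      by (rule adjoint_pair_sum[OF adjoint_pair_compose[OF adj Suc]])
    moreover have "os_pow B r m (B l w) = B l (os_pow B r m w)" for m l w
      using commutes_pow[OF lin com] by (simp add: commutes_def)
    ultimately show ?case by (simp add: os_mult_def[abs_def])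
  qed
  have "adjoint_pair (\<lambda>w. \<Sum>r\<le>k. mscale (1 / fact r) (os_pow A r k w))
     (\<lambda>w. \<Sum>r\<le>k. mscale (cnj (1 / fact r)) (os_pow B r k w))"
    by (intro adjoint_pair_sum adjoint_pair_scale pow)
  thus ?thesis by (simp add: os_exp_def[abs_def])
qed

text \<open>
  The lattice vector changes sign because \<open>\<alpha>(-k)\<close> occurs in the exponent of \<open>E\<^sub>-\<close> with the coefficient
  \<open>2/k\<close> and \<open>\<alpha>(k)\<close> in that of \<open>E\<^sub>+\<close> with \<open>-2/k\<close>.
\<close>

lemma adjoint_Eminus: "adjoint_pair (Eminus \<alpha> k) (Eplus (- \<alpha>) k)"
  unfolding Eminus_def Eplus_def
proof (rule adjoint_os_exp)
  let ?B = "\<lambda>k w. if odd k then mscale (- 2 / of_int (int k)) (heis_lat (- \<alpha>) (int k) w) else 0"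
  fix k
  show "fock_linear (?B k)"
    by (cases "odd k") (simp_all add: fock_linear_const0 fock_linear_compose[OF fock_linear_mscale fock_linear_heis_lat])
  show "commutes (?B k) ?B"
  proof -
    have "heis_lat (- \<alpha>) (int l) (heis_lat (- \<alpha>) (int k) w) = heis_lat (- \<alpha>) (int k) (heis_lat (- \<alpha>) (int l) w)"
      if "odd k" for l w
      by (rule heis_lat_commute) (use that in \<open>auto elim!: oddE\<close>)
    thus ?thesis
      by (simp add: commutes_def fock_linear_scale[OF fock_linear_heis_lat] mult.commute
          fock_linear_zero[OF fock_linear_heis_lat])
  qed
  have "adjoint_pair (\<lambda>w. mscale (2 / of_nat k) (heis_lat \<alpha> (- int k) w))
      (\<lambda>w. mscale (cnj (2 / of_nat k)) (heis_lat \<alpha> (- (- int k)) w))"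
    by (intro adjoint_pair_scale adjoint_heis_lat)
  moreover have "mscale (- 2 / of_int (int k)) (heis_lat (- \<alpha>) n w) = mscale (2 / of_nat k) (heis_lat \<alpha> n w)" for n w
    unfolding heis_lat_minus by (rule mscale_eqI) simp
  ultimately show "adjoint_pair (\<lambda>w. if odd k then mscale (- 2 / of_int (- int k)) (heis_lat \<alpha> (- int k) w) else 0) (?B k)"
    by (cases "odd k") (simp_all add: adjoint_pair_zero)
qed

lemma unit_cnj: "cmod a = 1 \<Longrightarrow> cnj a = inverse a"
  by (simp add: inverse_complex_def complex_eq_iff cmod_def)

text \<open>
  The parity signs of the two factors \<open>E\<^sub>+\<close> combine to \<open>(-1)\<^sup>p\<close>. Unitarity of \<open>a\<close> enters here: the powers
  of \<open>a\<close> become the powers of \<open>1/a\<close> that \<open>Eplus2\<close> contains.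
\<close>

lemma adjoint_Eminus2:
  assumes "cmod a = 1"
  shows "adjoint_pair (Eminus2 i j a p) (\<lambda>w. mscale ((- 1) ^ p) (Eplus2 i j a p w))"
proof -
  have "adjoint_pair (\<lambda>w. \<Sum>l\<le>p. Eminus (eps i) l (mscale (a ^ (p - l)) (Eminus (- eps j) (p - l) w)))
     (\<lambda>w. \<Sum>l\<le>p. Eplus (- (- eps j)) (p - l) (mscale (cnj (a ^ (p - l))) (Eplus (- eps i) l w)))"
    by (rule adjoint_pair_sum[OF adjoint_pair_compose[OF adjoint_Eminus
          adjoint_pair_compose[OF adjoint_pair_mscale adjoint_Eminus]]])
  moreover have "Eplus (- (- eps j)) (p - l) (mscale (cnj (a ^ (p - l))) (Eplus (- eps i) l w)) =
      mscale ((- 1) ^ p) (Eplus (eps i) l (mscale (inverse a ^ (p - l)) (Eplus (- eps j) (p - l) w)))"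
    if "l \<le> p" for l w
  proof -
    have "(- 1 :: complex) ^ l = (- 1) ^ p * (- 1) ^ (p - l)"
      using that by (simp add: power_add[symmetric] minus_one_power_iff)
    thus ?thesis
      unfolding minus_minus Eplus_minus fock_linear_scale[OF fock_linear_Eplus] mscale_mscale
        complex_cnj_power unit_cnj[OF assms] Eplus_commute[of "eps j"]
      by (simp only: mult.assoc mult.commute[of "inverse a ^ (p - l)"])
  qed
  ultimately show ?thesis
    by (simp add: Eminus2_def Eplus2_def os_mult_def[abs_def] os_dilate_def mscale_sum)
qed

text \<open>
  The adjoint of \<open>E\<^sub>- E\<^sub>+\<close> is again a product with \<open>E\<^sub>-\<close> on the left, in which the indices \<open>p\<close> and
  \<open>q\<close> of the two factors have changed places; hence \<open>n = q - p\<close> changes sign.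
\<close>

lemma adjoint_vertex:
  assumes "cmod a = 1"
  shows "adjoint_pair (vertex i j a n) (\<lambda>w. mscale ((- 1) powi n) (vertex i j a (- n) w))"
  unfolding adjoint_pair_def
proof (intro allI)
  fix v w :: "'a fock"
  define f where "f n w = (\<lambda>(p, q). if int q - int p = n then Eminus2 i j a p (Eplus2 i j a q w) else 0)" for n w
  have fin: "finite {x. f n w x \<noteq> 0}" for n w
    using vertex_summands_finite[of n i j a w] unfolding f_def by (simp add: case_prod_unfold)
  have ver: "vertex i j a n w = Sum_any (f n w)" for n w
    unfolding vertex_def f_def ..
  \<comment> \<open>one finite index set that serves both sums once the indices of the second are swapped\<close>
  define S where "S = {x. f n v x \<noteq> 0} \<union> prod.swap ` {x. f (- n) w x \<noteq> 0}"
  have S: "finite S" unfolding S_def by (intro finite_UnI finite_imageI fin)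
  have v: "vertex i j a n v = sum (f n v) S"
    unfolding ver by (rule Sum_any.expand_superset[OF S]) (auto simp: S_def)
  have "vertex i j a (- n) w = sum (f (- n) w) (prod.swap ` S)"
    unfolding ver by (rule Sum_any.expand_superset[OF finite_imageI[OF S]]) (auto simp: S_def image_Un image_image)
  also have "\<dots> = (\<Sum>x\<in>S. f (- n) w (prod.swap x))"
    by (subst sum.reindex) simp_all
  finally have w: "vertex i j a (- n) w = (\<Sum>x\<in>S. f (- n) w (prod.swap x))" .
  have "fock_form (f n v x) w = fock_form v (mscale ((- 1) powi n) (f (- n) w (prod.swap x)))" for x
  proof (cases x)
    case (Pair p q)
    have "adjoint_pair (Eplus2 i j a q) (\<lambda>w. mscale ((- 1) ^ q) (Eminus2 i j a q w))"
    proof -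
      have "adjoint_pair (\<lambda>w. mscale ((- 1) ^ q) (mscale ((- 1) ^ q) (Eplus2 i j a q w)))
          (\<lambda>w. mscale (cnj ((- 1) ^ q)) (Eminus2 i j a q w))"
        by (rule adjoint_pair_scale[OF adjoint_pair_sym[OF adjoint_Eminus2[OF assms]]])
      thus ?thesis by (simp add: power_mult_distrib[symmetric])
    qed
    hence "adjoint_pair (\<lambda>v. Eminus2 i j a p (Eplus2 i j a q v))
        (\<lambda>w. mscale ((- 1) ^ q) (Eminus2 i j a q (mscale ((- 1) ^ p) (Eplus2 i j a p w))))"
      by (rule adjoint_pair_compose[OF adjoint_Eminus2[OF assms]])
    moreover have "(- 1) ^ q * (- 1) ^ p = (- 1 :: complex) powi (int q - int p)"
      by (simp add: power_int_diff minus_one_power_iff)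
    ultimately show ?thesis
      using Pair by (auto simp: f_def adjoint_pair_def fock_linear_scale[OF fock_linear_Eminus2])
  qed
  thus "fock_form (vertex i j a n v) w = fock_form v (mscale ((- 1) powi n) (vertex i j a (- n) w))"
    by (simp add: v w mscale_sum fock_form_sum_left fock_form_sum_right)
qed

lemma red2_self_inverse: "red2 \<alpha> + (red2 \<alpha> + g) = g"
  by (simp add: vec_eq_iff add.assoc[symmetric])

lemma lookup_grp_op:
  "Poly_Mapping.lookup (grp_op \<alpha> w) g = cscale (cocyc \<alpha> (rep2 (red2 \<alpha> + g))) (Poly_Mapping.lookup w (red2 \<alpha> + g))"
proof (induction w rule: pm_induct)
  case (single h s)
  have "red2 \<alpha> + h = g \<longleftrightarrow> h = red2 \<alpha> + g" by (metis red2_self_inverse)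
  thus ?case
    using grp_op_single[of \<alpha> "rep2 h" s]
    by (auto simp: lookup_single when_def red2_add red2_self_inverse)
qed (simp add: grp_op_add lookup_add cscale_add)

lemma cocyc_cnj: "cnj (cocyc \<alpha> \<beta>) = cocyc \<alpha> \<beta>"
  unfolding cocyc_def cnj_prod by (intro prod.cong refl) simp

text \<open>
  Up to signs \<open>e\<^sup>\<alpha>\<close> permutes the orthogonal copies of the symmetric algebra isometrically. So its
  adjoint is its inverse, and the inverse is \<open>\<epsilon>(\<alpha>,\<alpha>) e\<^sup>\<alpha>\<close> because \<open>e\<^sup>\<alpha> e\<^sup>\<alpha> = \<epsilon>(\<alpha>,\<alpha>) = \<plusminus>1\<close>.
\<close>

lemma adjoint_grp_op: "adjoint_pair (grp_op \<alpha>) (\<lambda>w. mscale (cocyc \<alpha> \<alpha>) (grp_op \<alpha> w))"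
proof -
  have "fock_form (grp_op \<alpha> v) w = fock_form v (mscale (cocyc \<alpha> \<alpha>) (grp_op \<alpha> w))" for v w
  proof (induction v rule: pm_induct)
    case (single g s)
    have "cocyc \<alpha> (rep2 (red2 \<alpha> + g)) = cocyc \<alpha> \<alpha> * cocyc \<alpha> (rep2 g)"
      using cocyc_mod2[of "rep2 (red2 \<alpha> + g)" "\<alpha> + rep2 g" \<alpha>] by (simp add: red2_add cocyc_add_right)
    moreover have "cocyc \<alpha> \<alpha> * cocyc \<alpha> \<alpha> = 1"
      unfolding cocyc_def prod.distrib[symmetric]
      by (intro prod.neutral ballI) (simp add: power_int_mult_distrib[symmetric])
    ultimately show ?case
      using grp_op_single[of \<alpha> "rep2 g" s]
      by (simp add: red2_add fock_form_single lookup_grp_op sym_form_cscale_left sym_form_cscale_right cocyc_cnj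
          mult.assoc[symmetric])
  qed (simp add: grp_op_add fock_form_add_left)
  thus ?thesis by (simp add: adjoint_pair_def)
qed

lemma heis_grp_op: "heis i n (grp_op \<alpha> w) = grp_op \<alpha> (heis i n w)"
  by (rule poly_mapping_eqI)
    (auto simp: lookup_heis lookup_grp_op cscale_mult_right sym_deriv_cscale cscale_cscale mult.commute)

lemma heis_lat_grp_op: "heis_lat \<beta> n (grp_op \<alpha> w) = grp_op \<alpha> (heis_lat \<beta> n w)"
  by (simp add: heis_lat_def heis_grp_op fock_linear_sum[OF fock_linear_grp_op] grp_op_scale)

lemma commutes_dilate: "fock_linear B \<Longrightarrow> commutes B A \<Longrightarrow> commutes B (os_dilate a A)"
  by (simp add: commutes_def os_dilate_def fock_linear_scale)

lemma vertex_grp_op: "vertex i j a n (grp_op \<alpha> w) = grp_op \<alpha> (vertex i j a n w)"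
proof -
  have "commutes (grp_op \<alpha>) (Eminus \<beta>)" "commutes (grp_op \<alpha>) (Eplus \<beta>)" for \<beta>
    unfolding Eminus_def Eplus_def
    by (intro commutes_exp fock_linear_grp_op;
        simp add: commutes_def heis_lat_grp_op grp_op_scale fock_linear_zero[OF fock_linear_grp_op])+
  hence "commutes (grp_op \<alpha>) (Eminus2 i j a)" "commutes (grp_op \<alpha>) (Eplus2 i j a)"
    unfolding Eminus2_def Eplus2_def
    by (intro commutes_mult commutes_dilate fock_linear_grp_op; simp)+
  hence com: "Eminus2 i j a p (Eplus2 i j a q (grp_op \<alpha> v)) = grp_op \<alpha> (Eminus2 i j a p (Eplus2 i j a q v))" for p q v
    by (simp add: commutes_def)
  define f where "f w = (\<lambda>(p, q). if int q - int p = n then Eminus2 i j a p (Eplus2 i j a q w) else 0)" for w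
  have f: "f (grp_op \<alpha> w) x = grp_op \<alpha> (f w x)" for x
    by (cases x) (simp add: f_def com fock_linear_zero[OF fock_linear_grp_op])
  have fin: "finite {x. f w x \<noteq> 0}"
    using vertex_summands_finite[of n i j a w] unfolding f_def by (simp add: case_prod_unfold)
  have "Sum_any (f (grp_op \<alpha> w)) = sum (f (grp_op \<alpha> w)) {x. f w x \<noteq> 0}"
    by (rule Sum_any.expand_superset[OF fin]) (auto simp: f fock_linear_zero[OF fock_linear_grp_op])
  thus ?thesis
    by (simp add: vertex_def f_def[symmetric] f Sum_any.expand_set fock_linear_sum[OF fock_linear_grp_op])
qed

text \<open>
  The vertex operator contributes the sign \<open>(-1)\<^sup>m\<close>. One more sign comes from \<open>e\<^sup>\<alpha> e\<^sup>\<alpha> = -1\<close> for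
  \<open>\<alpha> = \<epsilon>\<^sub>i - \<epsilon>\<^sub>j\<close> if \<open>i \<noteq> j\<close>, and from \<open>(1 + a)/(1 - a)\<close>, which is purely imaginary on the unit circle,
  if \<open>i = j\<close> and \<open>a \<noteq> 1\<close>. For \<open>i = j\<close> and \<open>a = 1\<close> only odd modes are nonzero, where \<open>(-1)\<^sup>m\<^sup>+\<^sup>1 = 1\<close>.
\<close>

lemma adjoint_y_op:
  assumes "cmod a = 1"
  shows "adjoint_pair (y_op i j a m) (\<lambda>w. mscale ((- 1) powi (m + 1)) (y_op i j a (- m) w))"
proof -
  have sgn: "(- 1 :: complex) powi (m + 1) = - ((- 1) powi m)"
    by (simp add: power_int_add)
  show ?thesis
  proof (cases "i = j")
    case False
    let ?\<alpha> = "eps i - eps j"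
    have r: "cocyc (eps k) ?\<alpha> * cocyc (eps k) (eps j) = cocyc (eps k) (eps i)" for k
      using cocyc_add_right[of "eps k" ?\<alpha> "eps j"] by simp
    have l: "cocyc ?\<alpha> ?\<alpha> * cocyc (eps j) ?\<alpha> = cocyc (eps i) ?\<alpha>"
      using cocyc_add_left[of ?\<alpha> "eps j" ?\<alpha>] by simp
    have "cocyc (eps j) (eps i) = - cocyc (eps i) (eps j)" "cocyc (eps i) (eps j) ^ 2 = 1"
      "cocyc (eps i) (eps i) = 1" "cocyc (eps j) (eps j) = 1"
      using False by (auto simp: cocyc_eps)
    hence "cocyc ?\<alpha> ?\<alpha> = - 1"
      using l r[of i] r[of j] by algebra
    hence 1: "adjoint_pair (\<lambda>w. mscale (cocyc (eps i) (eps j)) (grp_op ?\<alpha> (vertex i j a m w)))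
        (\<lambda>w. mscale (cnj (cocyc (eps i) (eps j)))
          (mscale ((- 1) powi m) (vertex i j a (- m) (mscale (- 1) (grp_op ?\<alpha> w)))))"
      using adjoint_pair_scale[OF adjoint_pair_compose[OF adjoint_grp_op adjoint_vertex[OF assms]]] by metis
    thus ?thesis
      using False
      by (simp add: y_op_def[abs_def] x_op_def sgn cocyc_cnj fock_linear_scale[OF fock_linear_vertex] vertex_grp_op mult.commute)
  next
    case ij: True
    show ?thesis
    proof (cases "a = 1")
      case True
      have "adjoint_pair (\<lambda>w. mscale 4 (heis j m w)) (\<lambda>w. mscale (cnj 4) (heis j (- m) w))"
        by (intro adjoint_pair_scale adjoint_heis)
      moreover have "mscale ((- 1) powi (m + 1) * 4) (heis j (- m) w) = mscale 4 (heis j (- m) w)" for w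
        by (cases "even m") (simp_all add: heis_def)
      ultimately show ?thesis using ij True by (simp add: y_op_def[abs_def] x_op_def)
    next
      case False
      \<comment> \<open>the constant in \<open>y_op\<close> cancels the subtracted identity in \<open>x_op\<close>\<close>
      have y: "y_op j j a n = (\<lambda>w. mscale ((1 + a) / (1 - a)) (vertex j j a n w))" for n
        using False by (intro ext) (auto simp: y_op_def x_op_def mscale_diff)
      have a: "a \<noteq> 0" using assms by auto
      have k: "cnj ((1 + a) / (1 - a)) = - ((1 + a) / (1 - a))"
        using False a by (simp add: unit_cnj[OF assms] field_simps)
      have "adjoint_pair (\<lambda>w. mscale ((1 + a) / (1 - a)) (vertex j j a m w))
          (\<lambda>w. mscale (cnj ((1 + a) / (1 - a))) (mscale ((- 1) powi m) (vertex j j a (- m) w)))"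
        by (intro adjoint_pair_scale adjoint_vertex[OF assms])
      thus ?thesis
        unfolding ij y k sgn mscale_mscale by (simp only: mult_minus_left mult_minus_right mult.commute)
    qed
  qed
qed


section \<open>The conjugate anti-involution\<close>

lemma rbar_diff: "rbar \<sigma> (p - q) = rbar \<sigma> p - rbar \<sigma> q"
  using rbar_add[of \<sigma> p "- q"] by (simp add: rbar_uminus)

lemma rbar_cscale: "rbar \<sigma> (cscale c p) = cscale c (rbar \<sigma> p)"
proof (induction p rule: pm_induct)
  case (single k a) show ?case by (cases k) (simp add: rbar_single mult.assoc)
qed (simp add: rbar_add cscale_add)

lemma cscale_uminus: "cscale c (- p) = - cscale c p"
  by (rule poly_mapping_eqI) simp

lemma cscale_diff: "cscale c (p - q) = cscale c p - cscale c q"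
  by (rule poly_mapping_eqI) (simp add: lookup_minus algebra_simps)

definition skew_part :: "('g::ab_group_add \<Rightarrow> complex) \<Rightarrow> ('n::finite, 'g) gl \<Rightarrow> ('n, 'g) ghat" where
  "skew_part \<sigma> X = (X - gl_star \<sigma> X, 0)"

lemma skew_part_add: "skew_part \<sigma> (X + Y) = skew_part \<sigma> X + skew_part \<sigma> Y"
  by (simp add: skew_part_def gl_star_def vec_eq_iff rbar_add)

lemma u_hat_scale: "x \<in> u_hat \<sigma> \<Longrightarrow> hat_scale c x \<in> u_hat \<sigma>"
  by (simp add: u_hat_def gl_star_def hat_scale_def vec_eq_iff rbar_cscale cscale_uminus)

lemma u_hat_skew_part: "character \<sigma> \<Longrightarrow> skew_part \<sigma> X \<in> u_hat \<sigma>"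
  by (simp add: u_hat_def skew_part_def gl_star_def vec_eq_iff rbar_diff rbar_rbar)

lemma u_hat_hat_c: "hat_c \<in> u_hat \<sigma>"
  by (simp add: u_hat_def hat_c_def gl_star_def vec_eq_iff)

lemma skew_part_mat_unit:
  "skew_part \<sigma> (mat_unit i j p) = (mat_unit i j p - mat_unit j i (rbar \<sigma> p), 0)"
  by (simp add: skew_part_def gl_star_def mat_unit_def vec_eq_iff)

lemma e_gen_skew_part: "e_gen \<sigma> i j m \<alpha> = skew_part \<sigma> (mat_unit i j (Poly_Mapping.single (m, \<alpha>) 1))"
  by (simp add: e_gen_def skew_part_mat_unit)

lemma skew_part_single:
  "skew_part \<sigma> (mat_unit i j (Poly_Mapping.single (m, \<alpha>) c)) = hat_scale c (e_gen \<sigma> i j m \<alpha>)"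
proof -
  have "(mat_unit i j (cscale c p) - mat_unit j i (cscale c q)) $ k $ l =
      cscale c ((mat_unit i j p - mat_unit j i q) $ k $ l)" for p q :: "'a rsig" and k l
    by (simp only: mat_unit_def vector_minus_component vec_lambda_beta cscale_diff if_distrib[of "cscale c"] cscale_zero)
  hence "skew_part \<sigma> (mat_unit i j (cscale c p)) = hat_scale c (mat_unit i j p - mat_unit j i (rbar \<sigma> p), 0)" for p
    unfolding skew_part_mat_unit rbar_cscale hat_scale_def
    by (simp only: prod_eq_iff fst_conv snd_conv vec_eq_iff vec_lambda_beta mult_zero_right simp_thms)
  from this[of "Poly_Mapping.single (m, \<alpha>) 1"] show ?thesis by (simp add: e_gen_def)
qed

lemma matrix_eq_sum_mat_unit: "(\<Sum>i\<in>UNIV. \<Sum>j\<in>UNIV. mat_unit i j (X $ i $ j)) = X"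
proof -
  have "(\<Sum>i\<in>UNIV. \<Sum>j\<in>UNIV. mat_unit i j (X $ i $ j) $ k $ l) =
      (\<Sum>i\<in>UNIV. \<Sum>j\<in>UNIV. if j = l then (if i = k then X $ i $ j else 0) else 0)" for k l
    by (intro sum.cong refl) (auto simp: mat_unit_def)
  thus ?thesis by (simp add: vec_eq_iff sum.delta)
qed

text \<open>
  The \<open>e\<^sub>i\<^sub>j(m,\<alpha>)\<close> and \<open>c\<close> span the unitary Lie algebra, because a skew matrix is half of its own skew
  part, and the skew part of \<open>E\<^sub>i\<^sub>j t\<^sup>m e\<^sup>\<alpha>\<close> is \<open>e\<^sub>i\<^sub>j(m,\<alpha>)\<close>.
\<close>

lemma u_hat_induct [consumes 2, case_names gen central add scale]:
  assumes char: "character \<sigma>" and x: "x \<in> u_hat \<sigma>"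
    and gen: "\<And>i j m \<alpha>. P (e_gen \<sigma> i j m \<alpha>)" and central: "P hat_c"
    and add: "\<And>x y. x \<in> u_hat \<sigma> \<Longrightarrow> y \<in> u_hat \<sigma> \<Longrightarrow> P x \<Longrightarrow> P y \<Longrightarrow> P (x + y)"
    and scale: "\<And>c x. x \<in> u_hat \<sigma> \<Longrightarrow> P x \<Longrightarrow> P (hat_scale c x)"
  shows "P x"
proof -
  note skew = u_hat_skew_part[OF char]
  have e: "e_gen \<sigma> i j m \<alpha> \<in> u_hat \<sigma>" for i j m \<alpha>
    unfolding e_gen_skew_part by (rule skew)
  have unit: "P (skew_part \<sigma> (mat_unit i j p))" for i j p
  proof (induction p rule: pm_induct)
    case (single k c)
    show ?case by (cases k) (simp add: skew_part_single scale[OF e gen])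
  next
    case (add p q)
    have "mat_unit i j (p + q) = mat_unit i j p + mat_unit i j q"
      by (simp add: mat_unit_def vec_eq_iff)
    thus ?case using assms(5)[OF skew skew add] by (simp add: skew_part_add)
  qed
  have zero: "P (skew_part \<sigma> 0)"
    using unit[of undefined undefined 0] by (simp add: mat_unit_def vec_eq_iff zero_vec_def)
  have sum: "P (skew_part \<sigma> (sum f A))" if "\<And>k. P (skew_part \<sigma> (f k))" for f and A :: "'c set"
    using that by (induction A rule: infinite_finite_induct) (auto simp: skew_part_add zero intro: add skew)
  have "P (skew_part \<sigma> (\<Sum>i\<in>UNIV. \<Sum>j\<in>UNIV. mat_unit i j (fst x $ i $ j)))"
    by (intro sum unit)
  hence "P (skew_part \<sigma> (fst x))" by (simp add: matrix_eq_sum_mat_unit)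
  hence "P (hat_scale (1/2) (skew_part \<sigma> (fst x)) + hat_scale (snd x) hat_c)"
    by (intro add scale skew u_hat_hat_c u_hat_scale central)
  moreover have "hat_scale (1/2) (skew_part \<sigma> (fst x)) + hat_scale (snd x) hat_c = x"
  proof -
    have half: "cscale (1/2) (p - - p) = p" for p :: "'a rsig"
      by (rule poly_mapping_eqI) (simp only: lookup_cscale lookup_minus lookup_uminus, simp)
    have "gl_star \<sigma> (fst x) = - fst x" using x by (simp add: u_hat_def)
    thus ?thesis
      using half by (simp add: prod_eq_iff skew_part_def hat_scale_def hat_c_def vec_eq_iff)
  qed
  ultimately show ?thesis by simp
qed

lemma rdag_rdag:
  assumes "character \<sigma>" "\<And>\<alpha>. cmod (\<sigma> \<alpha>) = 1"
  shows "rdag \<sigma> (rdag \<sigma> p) = p"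
proof (induction p rule: pm_induct)
  case (single k a)
  show ?case
    by (cases k) (simp add: rdag_single character_minus[OF assms(1)] unit_cnj[OF assms(2)]
        power_int_inverse power_int_minus power_int_eq_0_iff character_nz[OF assms(1)] mult.assoc)
qed (simp add: rdag_add)

lemma rdag_rmult:
  assumes "character \<sigma>" "\<And>\<alpha>. cmod (\<sigma> \<alpha>) = 1"
  shows "rdag \<sigma> (rmult \<sigma> p q) = rmult \<sigma> (rdag \<sigma> q) (rdag \<sigma> p)"
proof (induction p rule: pm_induct)
  case (single k a)
  show ?case
  proof (induction q rule: pm_induct)
    case (single l b)
    show ?case
      by (cases k; cases l)
        (simp add: rmult_single rdag_single character_add[OF assms(1)] character_minus[OF assms(1)]
          unit_cnj[OF assms(2)] power_int_mult_distrib power_int_add power_int_inverse power_int_minus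
          character_nz[OF assms(1)] field_simps)
  qed (simp add: rmult_add_right rmult_add_left rdag_add)
qed (simp add: rmult_add_left rmult_add_right rdag_add)

text \<open>
  The cocycle of \<open>gl\<^sub>\<nu>(R\<^sub>\<sigma>)\<close> is the sum of this form on \<open>R\<^sub>\<sigma>\<close> over the pairs of entries that a trace multiplies
  (\<open>gl_cocycle_eq\<close>), which reduces its behaviour under \<open>tau_dag\<close> to that under \<open>rdag\<close>.
\<close>

definition r_cocycle :: "('g::ab_group_add \<Rightarrow> complex) \<Rightarrow> 'g rsig \<Rightarrow> 'g rsig \<Rightarrow> complex" where
  "r_cocycle \<sigma> p q = (\<Sum>k\<in>Poly_Mapping.keys p. \<Sum>l\<in>Poly_Mapping.keys q.
     (if fst k + fst l = 0 \<and> \<sigma> (snd k) * \<sigma> (snd l) = 1 then of_int (fst k) * \<sigma> (snd k) powi fst l else 0)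
       * Poly_Mapping.lookup p k * Poly_Mapping.lookup q l)"

lemma gl_cocycle_eq: "gl_cocycle \<sigma> X Y = (\<Sum>i\<in>UNIV. \<Sum>j\<in>UNIV. r_cocycle \<sigma> (X $ i $ j) (Y $ j $ i))"
  unfolding gl_cocycle_def r_cocycle_def case_prod_unfold by (intro sum.cong refl) auto

lemma r_cocycle_single:
  "r_cocycle \<sigma> (Poly_Mapping.single (m, \<alpha>) a) (Poly_Mapping.single (n, \<beta>) b) =
     (if m + n = 0 \<and> \<sigma> \<alpha> * \<sigma> \<beta> = 1 then of_int m * \<sigma> \<alpha> powi n else 0) * a * b"
proof (cases "a = 0 \<or> b = 0")
  case False
  hence "Poly_Mapping.keys (Poly_Mapping.single (m, \<alpha>) a) = {(m, \<alpha>)}" "Poly_Mapping.keys (Poly_Mapping.single (n, \<beta>) b) = {(n, \<beta>)}" by simp_all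
  thus ?thesis by (simp only: r_cocycle_def sum.insert finite.emptyI empty_iff simp_thms sum.empty fst_conv snd_conv
        lookup_single_eq add_0_right)
qed (auto simp: r_cocycle_def)

lemma r_cocycle_add_left: "r_cocycle \<sigma> (p + q) r = r_cocycle \<sigma> p r + r_cocycle \<sigma> q r"
  unfolding r_cocycle_def
  by (rule lext_add[where f = "\<lambda>k a. \<Sum>l\<in>Poly_Mapping.keys r.
     (if fst k + fst l = 0 \<and> \<sigma> (snd k) * \<sigma> (snd l) = 1 then of_int (fst k) * \<sigma> (snd k) powi fst l else 0)
       * a * Poly_Mapping.lookup r l"])
    (simp_all add: sum.distrib[symmetric] algebra_simps)

lemma r_cocycle_add_right: "r_cocycle \<sigma> r (p + q) = r_cocycle \<sigma> r p + r_cocycle \<sigma> r q"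
  unfolding r_cocycle_def sum.distrib[symmetric]
  by (intro sum.cong refl lext_add) (simp_all add: algebra_simps)

lemma r_cocycle_rdag:
  assumes "character \<sigma>" "\<And>\<alpha>. cmod (\<sigma> \<alpha>) = 1"
  shows "r_cocycle \<sigma> (rdag \<sigma> q) (rdag \<sigma> p) = cnj (r_cocycle \<sigma> p q)"
proof (induction p rule: pm_induct)
  case (single k a)
  show ?case
  proof (induction q rule: pm_induct)
    case (single l b)
    obtain m \<alpha> n \<beta> where kl: "k = (m, \<alpha>)" "l = (n, \<beta>)" by (cases k; cases l)
    show ?case
    proof (cases "m + n = 0 \<and> \<sigma> \<alpha> * \<sigma> \<beta> = 1")
      case True
      hence n: "n = - m" and b: "\<sigma> \<beta> = inverse (\<sigma> \<alpha>)"
        by (auto simp: inverse_unique)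
      show ?thesis
        by (simp add: kl n b rdag_single r_cocycle_single character_minus[OF assms(1)] unit_cnj[OF assms(2)]
            power_int_inverse power_int_minus character_nz[OF assms(1)])
    next
      case False
      hence neg: "\<not> (- n + - m = 0 \<and> \<sigma> (- \<beta>) * \<sigma> (- \<alpha>) = 1)"
        using character_nz[OF assms(1)] by (auto simp: character_minus[OF assms(1)] field_simps)
      show ?thesis
        by (simp only: kl rdag_single r_cocycle_single neg False if_False mult_zero_left complex_cnj_zero)
    qed
  qed (simp add: r_cocycle_add_left r_cocycle_add_right rdag_add)
qed (simp add: r_cocycle_add_left r_cocycle_add_right rdag_add)

lemma rbar_sum: "rbar \<sigma> (sum f A) = (\<Sum>x\<in>A. rbar \<sigma> (f x))"
  by (induction A rule: infinite_finite_induct) (simp_all add: rbar_add)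

lemma rdag_sum: "rdag \<sigma> (sum f A) = (\<Sum>x\<in>A. rdag \<sigma> (f x))"
  by (induction A rule: infinite_finite_induct) (simp_all add: rdag_add)

lemma rdag_diff: "rdag \<sigma> (p - q) = rdag \<sigma> p - rdag \<sigma> q"
  using rdag_add[of \<sigma> p "- q"] by (simp add: rdag_uminus)

lemma rmult_uminus: "rmult \<sigma> (- p) (- q) = rmult \<sigma> p q"
  using rmult_add_left[of \<sigma> p "- p" "- q"] rmult_add_right[of \<sigma> p q "- q"]
  by (simp add: add_eq_0_iff)

lemma u_hat_bracket:
  assumes char: "character \<sigma>" and x: "x \<in> u_hat \<sigma>" and y: "y \<in> u_hat \<sigma>"
  shows "hat_bracket \<sigma> x y \<in> u_hat \<sigma>"
proof -
  have star: "gl_star \<sigma> (gl_mult \<sigma> X Y) = gl_mult \<sigma> (gl_star \<sigma> Y) (gl_star \<sigma> X)" for X Y :: "('b, 'a) gl"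
    by (simp add: gl_star_def gl_mult_def vec_eq_iff rbar_sum rbar_rmult[OF char])
  have minus: "gl_mult \<sigma> (- X) (- Y) = gl_mult \<sigma> X Y" for X Y :: "('b, 'a) gl"
    by (simp add: gl_mult_def vec_eq_iff rmult_uminus)
  have diff: "gl_star \<sigma> (X - Y) = gl_star \<sigma> X - gl_star \<sigma> Y" for X Y :: "('b, 'a) gl"
    by (simp add: gl_star_def vec_eq_iff rbar_diff)
  show ?thesis
    using x y by (simp add: u_hat_def hat_bracket_def diff star minus)
qed

text \<open>
  For unitary \<open>\<sigma>\<close> the map \<open>rdag \<sigma>\<close> is the conjugate-linear extension of \<open>t\<^sup>m e\<^sup>\<alpha> \<mapsto> (t\<^sup>m e\<^sup>\<alpha>)\<^sup>-\<^sup>1\<close>, hence it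
  reverses products, and so does its composition with the transposition of matrices.
\<close>

lemma tau_dag_bracket:
  assumes "character \<sigma>" "\<And>\<alpha>. cmod (\<sigma> \<alpha>) = 1"
  shows "tau_dag \<sigma> (hat_bracket \<sigma> x y) = hat_bracket \<sigma> (tau_dag \<sigma> y) (tau_dag \<sigma> x)"
proof (rule prod_eqI)
  show "fst (tau_dag \<sigma> (hat_bracket \<sigma> x y)) = fst (hat_bracket \<sigma> (tau_dag \<sigma> y) (tau_dag \<sigma> x))"
    by (simp add: tau_dag_def hat_bracket_def gl_mult_def vec_eq_iff rdag_diff rdag_sum rdag_rmult[OF assms])
  show "snd (tau_dag \<sigma> (hat_bracket \<sigma> x y)) = snd (hat_bracket \<sigma> (tau_dag \<sigma> y) (tau_dag \<sigma> x))"
    by (simp add: tau_dag_def hat_bracket_def gl_cocycle_eq r_cocycle_rdag[OF assms])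
qed

lemma tau_dag_tau_dag:
  assumes "character \<sigma>" "\<And>\<alpha>. cmod (\<sigma> \<alpha>) = 1"
  shows "tau_dag \<sigma> (tau_dag \<sigma> x) = x"
  by (simp add: tau_dag_def prod_eq_iff vec_eq_iff rdag_rdag[OF assms])

lemma tau_eq_tau_dag:
  assumes sigma: "character \<sigma>" "\<And>\<alpha>. cmod (\<sigma> \<alpha>) = 1"
    and lin: "conj_linear_on (u_hat \<sigma>) \<tau>"
    and gen: "\<And>i j m \<alpha>. \<tau> (e_gen \<sigma> i j m \<alpha>) = hat_scale ((-1) powi (m + 1)) (e_gen \<sigma> i j (- m) \<alpha>)"
    and central: "\<tau> hat_c = hat_c"
    and x: "x \<in> u_hat \<sigma>"
  shows "\<tau> x = tau_dag \<sigma> x"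
  using sigma(1) x
proof (induction rule: u_hat_induct)
  case (gen i j m \<alpha>)
  show ?case by (simp only: assms(4) tau_exists(2)[OF sigma])
next
  case central
  show ?case by (simp only: assms(5) tau_exists(3)[OF sigma])
next
  case (add x y)
  thus ?case using lin tau_exists(1)[OF sigma] by (auto simp: conj_linear_on_def)
next
  case (scale c x)
  thus ?case using lin tau_exists(1)[OF sigma] unfolding conj_linear_on_def by metis
qed


section \<open>Unitarity\<close>

text \<open>
  Both sides of the adjoint relation are linear in the Lie algebra element, as \<open>\<tau>\<close> and the second
  argument of the form are both conjugate-linear; so it suffices to know it on the spanning elements.
\<close>

lemma adjoint_action:
  assumes sigma: "character \<sigma>" "\<And>\<alpha>. cmod (\<sigma> \<alpha>) = 1"
    and action: "fock_action \<sigma> \<rho>"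
    and lin: "conj_linear_on (u_hat \<sigma>) \<tau>"
    and gen: "\<And>i j m \<alpha>. \<tau> (e_gen \<sigma> i j m \<alpha>) = hat_scale ((-1) powi (m + 1)) (e_gen \<sigma> i j (- m) \<alpha>)"
    and central: "\<tau> hat_c = hat_c"
    and x: "x \<in> u_hat \<sigma>"
  shows "adjoint_pair (\<rho> x) (\<rho> (\<tau> x))"
  using sigma(1) x
proof (induction rule: u_hat_induct)
  case (gen i j m \<alpha>)
  have e: "e_gen \<sigma> i j n \<alpha> \<in> u_hat \<sigma>" for n
    unfolding e_gen_skew_part by (rule u_hat_skew_part[OF sigma(1)])
  have rho: "\<rho> (e_gen \<sigma> i j n \<alpha>) w = mscale (1/2) (y_op i j (\<sigma> \<alpha>) n w)" for n w
  proof -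
    have "mscale 2 (\<rho> (e_gen \<sigma> i j n \<alpha>) w) = y_op i j (\<sigma> \<alpha>) n w"
      using action e[of n] unfolding fock_action_def y_op_def by metis
    from arg_cong[OF this, of "mscale (1/2)"] show ?thesis by simp
  qed
  have rho_tau: "\<rho> (\<tau> (e_gen \<sigma> i j m \<alpha>)) w = mscale ((-1) powi (m + 1)) (\<rho> (e_gen \<sigma> i j (- m) \<alpha>) w)" for w
    using action e[of "- m"] unfolding fock_action_def assms(5) by blast
  have "adjoint_pair (\<lambda>w. mscale (1/2) (y_op i j (\<sigma> \<alpha>) m w))
      (\<lambda>w. mscale (cnj (1/2)) (mscale ((- 1) powi (m + 1)) (y_op i j (\<sigma> \<alpha>) (- m) w)))"
    by (intro adjoint_pair_scale adjoint_y_op sigma(2))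
  thus ?case by (simp add: adjoint_pair_def rho rho_tau mult.commute)
next
  case central
  have "\<rho> hat_c = mscale (1/2)" using action by (auto simp: fock_action_def)
  thus ?case using adjoint_pair_mscale[of "1/2"] by (simp add: assms(6))
next
  case (add x y)
  have "\<tau> x \<in> u_hat \<sigma>" "\<tau> y \<in> u_hat \<sigma>" "\<tau> (x + y) = \<tau> x + \<tau> y"
    using lin add.hyps by (auto simp: conj_linear_on_def)
  hence "\<rho> (x + y) w = \<rho> x w + \<rho> y w" "\<rho> (\<tau> (x + y)) w = \<rho> (\<tau> x) w + \<rho> (\<tau> y) w" for w
    using action add.hyps by (auto simp: fock_action_def)
  thus ?case using add.IH by (simp add: adjoint_pair_def fock_form_add_left fock_form_add_right)
next
  case (scale c x)
  have "\<tau> x \<in> u_hat \<sigma>" "\<tau> (hat_scale c x) = hat_scale (cnj c) (\<tau> x)"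
    using lin scale.hyps by (auto simp: conj_linear_on_def)
  hence "\<rho> (hat_scale c x) w = mscale c (\<rho> x w)" "\<rho> (\<tau> (hat_scale c x)) w = mscale (cnj c) (\<rho> (\<tau> x) w)" for w
    using action scale.hyps by (auto simp: fock_action_def)
  thus ?case using scale.IH by (simp add: adjoint_pair_def fock_form_scale_left fock_form_scale_right)
qed

theorem proposition4p3:
  fixes \<sigma> :: "'g::ab_group_add \<Rightarrow> complex"
    and \<rho> :: "('n::{finite,linorder}, 'g) ghat \<Rightarrow> 'n fock \<Rightarrow> 'n fock"
    and \<tau> :: "('n, 'g) ghat \<Rightarrow> ('n, 'g) ghat"
  assumes nu: "CARD('n) \<ge> 2"
    and sigma: "character \<sigma>" "\<And>\<alpha>. cmod (\<sigma> \<alpha>) = 1"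
    and action: "fock_action \<sigma> \<rho>"
    and tau_linear: "conj_linear_on (u_hat \<sigma>) \<tau>"
    and tau_e: "\<And>i j m \<alpha>. \<tau> (e_gen \<sigma> i j m \<alpha>) = hat_scale ((-1) powi (m + 1)) (e_gen \<sigma> i j (- m) \<alpha>)"
    and tau_c: "\<tau> hat_c = hat_c"
  shows "conj_anti_involution (u_hat \<sigma>) (hat_bracket \<sigma>) \<tau> \<and> unitary_module (u_hat \<sigma>) \<tau> \<rho>"
proof
  have L: "\<tau> x \<in> u_hat \<sigma>" if "x \<in> u_hat \<sigma>" for x
    using tau_linear that by (simp add: conj_linear_on_def)
  have eq: "\<tau> x = tau_dag \<sigma> x" if "x \<in> u_hat \<sigma>" for x
    by (rule tau_eq_tau_dag[OF sigma tau_linear tau_e tau_c that])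
  show "conj_anti_involution (u_hat \<sigma>) (hat_bracket \<sigma>) \<tau>"
    unfolding conj_anti_involution_def
  proof (intro conjI ballI tau_linear)
    show "\<tau> (\<tau> x) = x" if "x \<in> u_hat \<sigma>" for x
      using eq[OF that] eq[OF L[OF that]] by (simp add: tau_dag_tau_dag[OF sigma])
    show "\<tau> (hat_bracket \<sigma> x y) = hat_bracket \<sigma> (\<tau> y) (\<tau> x)" if "x \<in> u_hat \<sigma>" "y \<in> u_hat \<sigma>" for x y
      using that by (simp add: eq u_hat_bracket[OF sigma(1)] tau_dag_bracket[OF sigma])
  qed
  show "unitary_module (u_hat \<sigma>) \<tau> \<rho>"
    unfolding unitary_module_def
    using pos_def_hermitian_fock_form adjoint_action[OF sigma action tau_linear tau_e tau_c]
    by (auto simp: adjoint_pair_def)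
qed

end
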